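(* Let $\nu\in\mathbb{C}$ with $\mathrm{Re}(\nu)>-1$ and let $f\in S_{\nu}([0,\infty))$. Then $T_{\nu}(\mathcal{H}_{\nu}(f))=\mathcal{W}_{\nu}(T_{\nu}(f))$, i.e. for every real $z\neq 0$, $$T_{\nu}(\mathcal{H}_{\nu}(f))(z)=|z|^{-\nu-1}e^{\mathrm{sgn}(z)\pi i(\nu+1)/2}\,T_{\nu}(f)(-1/z).$$
   Context: $S([0,\infty))$ is the space of functions $f_1:[0,\infty)\to\mathbb{C}$ that are smooth on $[0,\infty)$ (one-sided at $0$) and such that $f_1$ and all its derivatives are rapidly decreasing at $\infty$. For $\mathrm{Re}(\nu)>-1$, $S_{\nu}([0,\infty))=\{f:[0,\infty)\to\mathbb{C} : f(x)=x^{1/2+\nu/2}f_1(x),\ f_1\in S([0,\infty))\}$. For $x>0$, $J_{\nu}(x)=\sum_{k=0}^{\infty}\frac{(-1)^k(x/2)^{\nu+2k}}{\Gamma(k+1)\Gamma(k+\nu+1)}$. The Hankel transform of order $\nu$ is $\mathcal{H}_{\nu}(f)(y)=\int_{0}^{\infty}f(x)\sqrt{xy}\,J_{\nu}(2\sqrt{xy})\,\frac{dx}{x}$ for $y>0$, with value at $y=0$ given by continuity (it is $0$); it maps $S_\nu([0,\infty))$ into itself. For $f\in S_\nu([0,\infty))$ and $z\in\mathbb{R}$, $T_{\nu}(f)(z)=(2\pi)^{-1/2}\int_{0}^{\infty}x^{-1/2+\nu/2}f(x)e^{ixz}\,dx$. For $\phi:\mathbb{R}^{*}\to\mathbb{C}$,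 $\mathcal{W}_{\nu}(\phi)(x)=|x|^{-\nu-1}e^{\mathrm{sgn}(x)\pi i(\nu+1)/2}\phi(-1/x)$ for $x\in\mathbb{R}^*=\mathbb{R}\setminus\{0\}$. *)

theory Defs
  imports "HOL-Analysis.Analysis"
begin

text \<open>
  Functions on \<open>[0,\<infinity>)\<close> are modelled as total functions on the reals; every definition below
  only uses their values at nonnegative arguments.
\<close>

text \<open>Iterated derivative on \<open>[0,\<infinity>)\<close>, one-sided at 0; meaningful only at arguments \<open>x \<ge> 0\<close>.\<close>

definition half_line_deriv :: "nat \<Rightarrow> (real \<Rightarrow> complex) \<Rightarrow> real \<Rightarrow> complex" where
  "half_line_deriv n f = ((\<lambda>g x. vector_derivative g (at x within {0..})) ^^ n) f"

definition schwartz_half_line :: "(real \<Rightarrow> complex) set" where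
  "schwartz_half_line = {f.
     (\<forall>n. half_line_deriv n f differentiable_on {0..}) \<and>
     (\<forall>n k. ((\<lambda>x. of_real (x ^ k) * half_line_deriv n f x) \<longlongrightarrow> 0) at_top)}"

text \<open>
  Since \<open>0 powr a = 0\<close>, members of this space vanish at 0, which agrees with the continuous
  extension because \<open>Re (1/2 + \<nu>/2) > 0\<close> whenever \<open>Re \<nu> > -1\<close>.
\<close>

definition schwartz_hankel :: "complex \<Rightarrow> (real \<Rightarrow> complex) set" where
  "schwartz_hankel \<nu> = {f. \<exists>f1 \<in> schwartz_half_line.
     \<forall>x\<ge>0. f x = of_real x powr (1/2 + \<nu>/2) * f1 x}"

definition bessel_J :: "complex \<Rightarrow> real \<Rightarrow> complex" where
  "bessel_J \<nu> x = (\<Sum>k. (-1) ^ k * of_real (x / 2) powr (\<nu> + 2 * of_nat k) /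
     (Gamma (of_nat k + 1) * Gamma (of_nat k + \<nu> + 1)))"

text \<open>The value at 0 is the limit of the values at \<open>y > 0\<close>; negative \<open>y\<close> are outside the domain.\<close>

definition hankel :: "complex \<Rightarrow> (real \<Rightarrow> complex) \<Rightarrow> real \<Rightarrow> complex" where
  "hankel \<nu> f y = (if y > 0
     then (LINT x:{0<..}|lborel.
             f x * of_real (sqrt (x * y)) * bessel_J \<nu> (2 * sqrt (x * y)) / of_real x)
     else 0)"

definition T_transform :: "complex \<Rightarrow> (real \<Rightarrow> complex) \<Rightarrow> real \<Rightarrow> complex" where
  "T_transform \<nu> f z = of_real ((2 * pi) powr (-1/2)) *
     (LINT x:{0<..}|lborel.
        of_real x powr (-1/2 + \<nu>/2) * f x * exp (\<i> * of_real x * of_real z))"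

text \<open>Meaningful only at \<open>x \<noteq> 0\<close>.\<close>

definition W_operator :: "complex \<Rightarrow> (real \<Rightarrow> complex) \<Rightarrow> real \<Rightarrow> complex" where
  "W_operator \<nu> \<phi> x =
     of_real \<bar>x\<bar> powr (-\<nu> - 1) * exp (of_real (sgn x) * of_real pi * \<i> * (\<nu> + 1) / 2) * \<phi> (-1 / x)"

end

theory Submission
  imports Defs
begin

text \<open>
  Write \<open>E\<^sub>\<mu>(t) = (\<Sum>k. (-t)^k / (k! \<Gamma>(k+\<mu>+1)))\<close>, so that \<open>J\<^sub>\<nu>(2 \<surd>t) = t powr (\<nu>/2) E\<^sub>\<nu>(t)\<close>. For
  \<open>f x = x powr (1/2+\<nu>/2) f1(x)\<close> the Hankel transform is \<open>y powr (1/2+\<nu>/2) g(y)\<close> with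
  \<open>g(y) = \<integral> x powr \<nu> f1(x) E\<^sub>\<nu>(x y) dx\<close>. For \<open>Re s > 0\<close>, termwise integration shows that the Laplace
  transform of \<open>y powr \<nu> E\<^sub>\<nu>(x y)\<close> is \<open>s powr (-\<nu>-1) exp(-x/s)\<close>, so by Fubini the Laplace
  transform of \<open>y powr \<nu> g(y)\<close> is \<open>s powr (-\<nu>-1) \<integral> x powr \<nu> f1(x) exp(-x/s) dx\<close>; the claim is
  the limit \<open>s \<rightarrow> -\<i>z\<close>.

  The limit requires \<open>g\<close> to decay rapidly. Since \<open>E\<^sub>\<mu>' = -E\<^sub>\<mu>\<^sub>+\<^sub>1\<close>, an energy estimate for the
  differential equation of \<open>E\<^sub>\<mu>\<close> bounds \<open>E\<^sub>\<mu>\<close> when \<open>Re \<mu> \<ge> -1/2\<close>, and the three-term recurrence upgrades this to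
  \<open>E\<^sub>\<mu>(t) = O(t powr -k)\<close> when \<open>Re \<mu> \<ge> 2k\<close>. Integrating by parts \<open>2k+1\<close> times replaces \<open>E\<^sub>\<nu>\<close> by
  \<open>E\<^sub>\<nu>\<^sub>+\<^sub>2\<^sub>k\<^sub>+\<^sub>1\<close> and yields \<open>g(y) = O(y powr -k)\<close>.
\<close>

section \<open>The Bessel--Clifford function\<close>

text \<open>The entire function \<open>rGamma\<close> takes the place of a quotient by
  \<open>Gamma\<close>, so the coefficient makes sense at every order, poles of \<open>Gamma\<close>
  included.\<close>

definition bc_coeff :: "complex \<Rightarrow> nat \<Rightarrow> complex" where
  "bc_coeff \<mu> k = (-1) ^ k * rGamma (of_nat k + \<mu> + 1) / fact k"

text \<open>The argument is complex so that the calculus of complex power series applies directly;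
  the estimates concern real \<open>t \<ge> 0\<close>.\<close>

definition bessel_clifford :: "complex \<Rightarrow> complex \<Rightarrow> complex" where
  "bessel_clifford \<mu> t = (\<Sum>k. bc_coeff \<mu> k * t ^ k)"

section \<open>Coefficient bounds and convergence of the power series\<close>

lemma pochhammer_norm_ge:
  fixes z :: complex
  assumes "Re z > 0"
  shows "pochhammer (Re z) k \<le> norm (pochhammer z k)"
proof (induction k)
  case (Suc k)
  \<comment> \<open>Each factor of the Pochhammer product has norm at least its real part.\<close>
  have "Re z + real k \<le> norm (z + of_nat k)"
    using complex_Re_le_cmod[of "z + of_nat k"] by simp
  then have "(Re z + real k) * pochhammer (Re z) k \<le> norm (z + of_nat k) * norm (pochhammer z k)"
    using assms Suc by (intro mult_mono pochhammer_nonneg) auto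
  then show ?case
    unfolding pochhammer_rec' norm_mult by simp
qed simp

lemma rGamma_add_nat:
  fixes z :: complex
  assumes "Re z > 0"
  shows "rGamma (of_nat k + z) = rGamma z / pochhammer z k"
proof -
  have "pochhammer z k \<noteq> 0"
    using assms by (auto simp: pochhammer_eq_0_iff)
  then show ?thesis
    using pochhammer_rGamma[of z k] by (simp add: add.commute)
qed

text \<open>The empty product is 1; otherwise the first factor is \<open>a\<close> and all later
  ones are at least 1.\<close>

lemma pochhammer_ge_min:
  fixes a :: real
  assumes "a > 0"
  shows "min 1 a \<le> pochhammer a k"
proof (cases k)
  case (Suc m)
  have "1 \<le> pochhammer (a + 1) m"
  proof (induction m)
    case (Suc m)
    then show ?case
      using assms mult_mono[of 1 "a + 1 + real m" 1 "pochhammer (a + 1) m"] by (simp add: pochhammer_rec')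
  qed simp
  then show ?thesis
    using Suc assms mult_left_mono[of 1 "pochhammer (a + 1) m" a]
    by (simp add: pochhammer_rec min.coboundedI2)
qed simp

text \<open>The Pochhammer factor is kept because it later cancels against
  \<open>Gamma (Re \<nu> + 1 + real k)\<close> in the termwise Laplace integration; convergence of
  the series itself follows from the cruder \<open>bc_coeff_bound\<close>.\<close>

lemma norm_bc_coeff_le:
  assumes "Re \<mu> > -1"
  shows "norm (bc_coeff \<mu> k) \<le> norm (rGamma (\<mu> + 1)) / pochhammer (Re \<mu> + 1) k / fact k"
proof -
  have "norm (bc_coeff \<mu> k) = norm (rGamma (\<mu> + 1)) / norm (pochhammer (\<mu> + 1) k) / fact k"
    using assms rGamma_add_nat[of "\<mu> + 1" k]
    by (simp add: bc_coeff_def norm_mult norm_divide norm_power add.assoc)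
  also have "\<dots> \<le> norm (rGamma (\<mu> + 1)) / pochhammer (Re \<mu> + 1) k / fact k"
    using pochhammer_norm_ge[of "\<mu> + 1" k] assms pochhammer_pos[of "Re \<mu> + 1" k]
    by (intro divide_right_mono divide_left_mono mult_pos_pos) auto
  finally show ?thesis .
qed

lemma bc_coeff_bound:
  assumes "Re \<mu> > -1"
  shows "norm (bc_coeff \<mu> k) \<le> norm (rGamma (\<mu> + 1)) / min 1 (Re \<mu> + 1) / fact k" (is "_ \<le> ?K / _")
proof -
  note norm_bc_coeff_le[OF assms, of k]
  also have "norm (rGamma (\<mu> + 1)) / pochhammer (Re \<mu> + 1) k / fact k \<le> ?K / fact k"
    using pochhammer_ge_min[of "Re \<mu> + 1" k] assms
    by (intro divide_right_mono divide_left_mono mult_pos_pos) auto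
  finally show ?thesis .
qed

lemma summable_norm_bc:
  assumes "Re \<mu> > -1"
  shows "summable (\<lambda>k. norm (bc_coeff \<mu> k * t ^ k))"
proof -
  let ?K = "norm (rGamma (\<mu> + 1)) / min 1 (Re \<mu> + 1)"
  note K = bc_coeff_bound[OF assms]
  show ?thesis
  proof (rule summable_comparison_test)
    show "summable (\<lambda>k. ?K * (norm t ^ k / fact k))"
      using summable_exp[of "norm t"] by (intro summable_mult) (simp add: field_simps)
    have "norm (bc_coeff \<mu> k) * norm t ^ k \<le> ?K / fact k * norm t ^ k" for k
      by (intro mult_right_mono K) auto
    then show "\<exists>N. \<forall>n\<ge>N. norm (norm (bc_coeff \<mu> n * t ^ n)) \<le> ?K * (norm t ^ n / fact n)"
      by (auto simp: norm_mult norm_power)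
  qed
qed

lemma summable_bc: "Re \<mu> > -1 \<Longrightarrow> summable (\<lambda>k. bc_coeff \<mu> k * t ^ k)"
  by (rule summable_norm_cancel[OF summable_norm_bc])

section \<open>Differentiation in the argument and the three-term recurrence in the order\<close>

lemma diffs_bc_coeff: "diffs (bc_coeff \<mu>) k = - bc_coeff (\<mu> + 1) k"
proof -
  have "1 + of_nat k \<noteq> (0::complex)"
    by (metis of_nat_Suc of_nat_neq_0)
  then show ?thesis
    by (simp add: diffs_def bc_coeff_def add_ac divide_simps)
qed

lemma bessel_clifford_deriv:
  assumes "Re \<mu> > -1"
  shows "(bessel_clifford \<mu> has_field_derivative - bessel_clifford (\<mu> + 1) t) (at t)"
proof -
  have "((\<lambda>x. \<Sum>n. bc_coeff \<mu> n * x ^ n) has_field_derivative (\<Sum>n. diffs (bc_coeff \<mu>) n * t ^ n)) (at t)"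
    by (rule termdiffs_strong_converges_everywhere) (rule summable_bc[OF assms])
  moreover have "(\<Sum>n. diffs (bc_coeff \<mu>) n * t ^ n) = - bessel_clifford (\<mu> + 1) t"
    unfolding diffs_bc_coeff bessel_clifford_def
    using suminf_minus[OF summable_bc[of "\<mu> + 1" t]] assms by simp
  ultimately show ?thesis by (simp add: bessel_clifford_def[abs_def])
qed

text \<open>Coefficients of equal powers of \<open>t\<close> are compared: both the constant term
  and the higher terms reduce to the functional equation of \<open>rGamma\<close>. The factor
  \<open>t\<close> shifts the index of the last series by one, hence the separate treatment of the
  head.\<close>

lemma bessel_clifford_recurrence:
  assumes "Re \<mu> > -1"
  shows "bessel_clifford \<mu> t = (\<mu> + 1) * bessel_clifford (\<mu> + 1) t - t * bessel_clifford (\<mu> + 2) t"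
proof -
  have c0: "bc_coeff \<mu> 0 = (\<mu> + 1) * bc_coeff (\<mu> + 1) 0"
    using rGamma_plus1[of "\<mu> + 1"] by (simp add: bc_coeff_def add_ac)
  have k0: "1 + of_nat k \<noteq> (0::complex)" for k
    by (metis of_nat_Suc of_nat_neq_0)
  have cS: "bc_coeff \<mu> (Suc k) = (\<mu> + 1) * bc_coeff (\<mu> + 1) (Suc k) - bc_coeff (\<mu> + 2) k" for k
  proof -
    have "rGamma (\<mu> + (of_nat k + 2)) = (\<mu> + of_nat k + 2) * rGamma (\<mu> + (of_nat k + 3))"
      using rGamma_plus1[of "\<mu> + of_nat k + 2"] by (simp add: add_ac)
    with k0[of k] show ?thesis
      by (simp add: bc_coeff_def add_ac divide_simps) (simp add: algebra_simps)
  qed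
  have s: "summable (\<lambda>k. bc_coeff \<mu>' k * t ^ k)" if "\<mu>' = \<mu> \<or> \<mu>' = \<mu> + 1 \<or> \<mu>' = \<mu> + 2" for \<mu>'
    using that assms by (intro summable_bc) auto
  have S: "bessel_clifford \<mu>' t = bc_coeff \<mu>' 0 + (\<Sum>k. bc_coeff \<mu>' (Suc k) * t ^ Suc k)"
    "summable (\<lambda>k. bc_coeff \<mu>' (Suc k) * t ^ Suc k)"
    if "\<mu>' = \<mu> \<or> \<mu>' = \<mu> + 1 \<or> \<mu>' = \<mu> + 2" for \<mu>'
    using suminf_split_head[OF s[OF that]] summable_Suc_iff[of "\<lambda>k. bc_coeff \<mu>' k * t ^ k"] s[OF that]
    by (simp_all add: bessel_clifford_def)
  have "(\<lambda>k. (\<mu> + 1) * (bc_coeff (\<mu> + 1) (Suc k) * t ^ Suc k) - t * (bc_coeff (\<mu> + 2) k * t ^ k)) sums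
     ((\<mu> + 1) * (\<Sum>k. bc_coeff (\<mu> + 1) (Suc k) * t ^ Suc k) - t * bessel_clifford (\<mu> + 2) t)"
    unfolding bessel_clifford_def
    by (intro sums_diff sums_mult summable_sums s S) auto
  moreover have "(\<lambda>k. (\<mu> + 1) * (bc_coeff (\<mu> + 1) (Suc k) * t ^ Suc k) - t * (bc_coeff (\<mu> + 2) k * t ^ k))
     = (\<lambda>k. bc_coeff \<mu> (Suc k) * t ^ Suc k)"
    by (simp add: cS algebra_simps)
  ultimately have "(\<Sum>k. bc_coeff \<mu> (Suc k) * t ^ Suc k) =
      (\<mu> + 1) * (\<Sum>k. bc_coeff (\<mu> + 1) (Suc k) * t ^ Suc k) - t * bessel_clifford (\<mu> + 2) t"
    using sums_unique by metis
  then show ?thesis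
    using S(1)[of \<mu>] S(1)[of "\<mu> + 1"] c0 by (simp only: simp_thms) (simp add: distrib_left)
qed

section \<open>Real-variable derivative and bounds on the half line\<close>

lemma bessel_clifford_deriv_of_real:
  assumes "Re \<mu> > -1"
  shows "((\<lambda>t. bessel_clifford \<mu> (of_real t)) has_vector_derivative
           - bessel_clifford (\<mu> + 1) (of_real t)) (at t within A)"
  using has_vector_derivative_real_field[OF bessel_clifford_deriv[OF assms], of t A] .

text \<open>A nonincreasing energy dominates the squared norm and coincides with it at 0, where the
  weight \<open>t\<close> of its second summand vanishes.\<close>

lemma norm_bessel_clifford_le:
  assumes "Re \<mu> \<ge> -1/2" "0 \<le> t"
  shows "norm (bessel_clifford \<mu> (of_real t)) \<le> norm (bessel_clifford \<mu> 0)"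
proof -
  let ?E = "\<lambda>(j::nat) (t::real). bessel_clifford (\<mu> + of_nat j) (of_real t)"
  let ?V = "\<lambda>t. ?E 0 t \<bullet> ?E 0 t + t * (?E 1 t \<bullet> ?E 1 t)"
  have dE: "(?E j has_vector_derivative - ?E (Suc j) t) (at t)" for j t
    using bessel_clifford_deriv_of_real[of "\<mu> + of_nat j" t UNIV] assms by (simp add: add_ac)
  have dI: "((\<lambda>t. ?E j t \<bullet> ?E j t) has_vector_derivative - 2 * (?E j t \<bullet> ?E (Suc j) t)) (at t)" for j t
    using bounded_bilinear.has_vector_derivative[OF bounded_bilinear_inner dE[of j t] dE[of j t]]
    by (simp add: inner_commute)
  \<comment> \<open>\<open>?V\<close> is the energy \<open>\<bar>E\<bar>\<^sup>2 + t \<bar>E'\<bar>\<^sup>2\<close> of a solution of \<open>t E'' + (\<mu> + 1) E' + E = 0\<close>.\<close>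
  have "?V t \<le> ?V 0"
  proof (rule DERIV_nonpos_imp_nonincreasing[OF assms(2)])
    fix s :: real assume s: "0 \<le> s"
    let ?D = "- 2 * (?E 0 s \<bullet> ?E 1 s) + (?E 1 s \<bullet> ?E 1 s + s * (- 2 * (?E 1 s \<bullet> ?E 2 s)))"
    have "(?V has_real_derivative ?D) (at s)"
    proof -
      note d = dI[of _ s, unfolded has_real_derivative_iff_has_vector_derivative[symmetric]]
      show ?thesis
        using DERIV_add[OF d[of 0] DERIV_mult[OF DERIV_ident d[of 1]]]
        by (simp add: numeral_2_eq_2 mult_ac)
    qed
    moreover have a: "?E 0 s = (\<mu> + 1) * ?E 1 s - of_real s * ?E 2 s"
      using bessel_clifford_recurrence[of \<mu> "of_real s"] assms by simp
    \<comment> \<open>Inserting the recurrence for \<open>?E 0 s\<close> cancels the mixed terms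
      \<open>?E 1 s \<bullet> ?E 2 s\<close>. The sign of the surviving factor is where
      \<open>Re \<mu> \<ge> -1/2\<close> enters.\<close>
    have D: "?D = - (2 * Re \<mu> + 1) * (?E 1 s \<bullet> ?E 1 s)"
      unfolding a by (simp add: inner_complex_def algebra_simps)
    have "?D \<le> 0"
      unfolding D using assms by (intro mult_nonpos_nonneg inner_ge_zero) auto
    ultimately show "\<exists>y. (?V has_real_derivative y) (at s) \<and> y \<le> 0" by blast
  qed
  moreover have "0 \<le> t * (?E 1 t \<bullet> ?E 1 t)" using assms by simp
  ultimately have "?E 0 t \<bullet> ?E 0 t \<le> ?E 0 0 \<bullet> ?E 0 0" by simp
  then show ?thesis
    unfolding dot_square_norm using power2_le_imp_le[OF _ norm_ge_zero] by simp
qed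

lemma continuous_on_bessel_clifford [continuous_intros]:
  assumes "Re \<mu> > -1" "continuous_on A f"
  shows "continuous_on A (\<lambda>x. bessel_clifford \<mu> (f x))"
proof -
  have "continuous_on UNIV (bessel_clifford \<mu>)"
    using bessel_clifford_deriv[OF assms(1)] by (intro continuous_at_imp_continuous_on) (blast intro: DERIV_isCont)
  then show ?thesis
    using continuous_on_compose2[OF _ assms(2)] by blast
qed

text \<open>Solved for its last term, the recurrence expresses \<open>t\<close> times the function
  of order \<open>\<mu>\<close> through the orders \<open>\<mu> - 1\<close> and
  \<open>\<mu> - 2\<close>. Each power of \<open>t\<close> gained thus costs 2 in the real part of
  the order, which explains the hypothesis.\<close>

lemma bessel_clifford_decay:
  assumes "Re \<mu> \<ge> 2 * real k"
  shows "\<exists>C\<ge>0. \<forall>t\<ge>0. t ^ k * norm (bessel_clifford \<mu> (of_real t)) \<le> C"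
  using assms
proof (induction k arbitrary: \<mu>)
  case 0
  then show ?case
    by (intro exI[of _ "norm (bessel_clifford \<mu> 0)"]) (auto intro: norm_bessel_clifford_le)
next
  case (Suc k)
  obtain C1 where C1: "C1 \<ge> 0" "\<And>t. t \<ge> 0 \<Longrightarrow> t ^ k * norm (bessel_clifford (\<mu> - 1) (of_real t)) \<le> C1"
    using Suc.IH[of "\<mu> - 1"] Suc.prems by auto
  obtain C2 where C2: "C2 \<ge> 0" "\<And>t. t \<ge> 0 \<Longrightarrow> t ^ k * norm (bessel_clifford (\<mu> - 2) (of_real t)) \<le> C2"
    using Suc.IH[of "\<mu> - 2"] Suc.prems by auto
  show ?case
  proof (intro exI[of _ "norm (\<mu> - 1) * C1 + C2"] conjI allI impI)
    fix t :: real assume t: "0 \<le> t"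
    have "of_real t * bessel_clifford \<mu> (of_real t)
        = (\<mu> - 1) * bessel_clifford (\<mu> - 1) (of_real t) - bessel_clifford (\<mu> - 2) (of_real t)"
      using bessel_clifford_recurrence[of "\<mu> - 2" "of_real t"] Suc.prems by simp
    then have "t * norm (bessel_clifford \<mu> (of_real t)) \<le>
        norm (\<mu> - 1) * norm (bessel_clifford (\<mu> - 1) (of_real t)) + norm (bessel_clifford (\<mu> - 2) (of_real t))"
      using norm_triangle_ineq4[of "(\<mu> - 1) * bessel_clifford (\<mu> - 1) (of_real t)" "bessel_clifford (\<mu> - 2) (of_real t)"] t
      by (metis abs_of_nonneg norm_mult norm_of_real)
    then have "t ^ k * (t * norm (bessel_clifford \<mu> (of_real t))) \<le>
        t ^ k * (norm (\<mu> - 1) * norm (bessel_clifford (\<mu> - 1) (of_real t)) + norm (bessel_clifford (\<mu> - 2) (of_real t)))"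
      using t by (intro mult_left_mono) auto
    also have "\<dots> = norm (\<mu> - 1) * (t ^ k * norm (bessel_clifford (\<mu> - 1) (of_real t)))
                  + t ^ k * norm (bessel_clifford (\<mu> - 2) (of_real t))"
      by (simp add: algebra_simps)
    also have "\<dots> \<le> norm (\<mu> - 1) * C1 + C2"
      using t by (intro add_mono mult_left_mono C1 C2) auto
    finally show "t ^ Suc k * norm (bessel_clifford \<mu> (of_real t)) \<le> norm (\<mu> - 1) * C1 + C2"
      by (simp add: mult_ac)
  qed (use C1 C2 in auto)
qed

text \<open>The energy bound does not cover orders with real part between -1 and -1/2. One use of
  the recurrence passes to \<open>\<mu> + 1\<close> and \<open>\<mu> + 2\<close>, where it applies,
  at the price of a factor \<open>t\<close>.\<close>

lemma bessel_clifford_linear_bound: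
  assumes "Re \<mu> > -1"
  shows "\<exists>C\<ge>0. \<forall>t\<ge>0. norm (bessel_clifford \<mu> (of_real t)) \<le> C * (1 + t)"
proof (intro exI[of _ "norm ((\<mu> + 1) * bessel_clifford (\<mu> + 1) 0) + norm (bessel_clifford (\<mu> + 2) 0)"] conjI allI impI)
  fix t :: real assume t: "0 \<le> t"
  have 1: "norm (bessel_clifford (\<mu> + 1) (of_real t)) \<le> norm (bessel_clifford (\<mu> + 1) 0)"
    and 2: "norm (bessel_clifford (\<mu> + 2) (of_real t)) \<le> norm (bessel_clifford (\<mu> + 2) 0)"
    using assms t by (auto intro!: norm_bessel_clifford_le)
  have "norm (bessel_clifford \<mu> (of_real t)) \<le> norm ((\<mu> + 1) * bessel_clifford (\<mu> + 1) (of_real t)) +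
      norm (of_real t * bessel_clifford (\<mu> + 2) (of_real t))"
    unfolding bessel_clifford_recurrence[OF assms] by (rule norm_triangle_ineq4)
  also have "\<dots> \<le> norm ((\<mu> + 1) * bessel_clifford (\<mu> + 1) 0) + t * norm (bessel_clifford (\<mu> + 2) 0)"
    unfolding norm_mult using t by (intro add_mono mult_mono 1 2) auto
  also have "\<dots> \<le> (norm ((\<mu> + 1) * bessel_clifford (\<mu> + 1) 0) + norm (bessel_clifford (\<mu> + 2) 0)) * (1 + t)"
    using t by (simp add: algebra_simps)
  finally show "norm (bessel_clifford \<mu> (of_real t)) \<le> \<dots>" .
qed simp

lemma bessel_J_conv_bessel_clifford:
  assumes "Re \<nu> > -1" "t > 0"
  shows "bessel_J \<nu> (2 * sqrt t) = of_real t powr (\<nu> / 2) * bessel_clifford \<nu> (of_real t)"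
proof -
  \<comment> \<open>Halving \<open>2 * sqrt t\<close> leaves the base \<open>sqrt t\<close>, a
    positive real with logarithm \<open>ln t / 2\<close>, so the principal power splits without a
    branch problem.\<close>
  have sqrt_powr: "complex_of_real (sqrt t) powr (\<nu> + 2 * of_nat k) = of_real t powr (\<nu> / 2) * of_real t ^ k" for k
  proof -
    have "complex_of_real (sqrt t) powr (\<nu> + 2 * of_nat k) = exp ((\<nu> + 2 * of_nat k) * of_real (ln t / 2))"
      using assms by (simp add: powr_def Ln_of_real ln_sqrt del: of_real_divide)
    also have "\<dots> = exp (\<nu> / 2 * of_real (ln t)) * exp (of_nat k * of_real (ln t))"
      by (simp add: exp_add[symmetric] algebra_simps)
    also have "\<dots> = of_real t powr (\<nu> / 2) * of_real t ^ k"
      using assms by (simp add: powr_def Ln_of_real exp_of_nat_mult exp_of_real)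
    finally show ?thesis .
  qed
  have "bessel_J \<nu> (2 * sqrt t) = (\<Sum>k. of_real t powr (\<nu> / 2) * (bc_coeff \<nu> k * of_real t ^ k))"
    unfolding bessel_J_def
  proof (rule suminf_cong)
    fix k
    have "Gamma (of_nat k + 1 :: complex) = fact k"
      using Gamma_fact[of k] by (simp add: add.commute)
    then show "(- 1) ^ k * complex_of_real (2 * sqrt t / 2) powr (\<nu> + 2 * of_nat k) /
        (Gamma (of_nat k + 1) * Gamma (of_nat k + \<nu> + 1)) =
        of_real t powr (\<nu> / 2) * (bc_coeff \<nu> k * of_real t ^ k)"
      by (simp add: sqrt_powr bc_coeff_def rGamma_inverse_Gamma divide_simps)
  qed
  also have "\<dots> = of_real t powr (\<nu> / 2) * bessel_clifford \<nu> (of_real t)"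
    unfolding bessel_clifford_def by (rule suminf_mult[OF summable_bc[OF assms(1)]])
  finally show ?thesis .
qed

section \<open>Laplace transforms\<close>

text \<open>For \<open>c = 1\<close> the integral is Euler's Gamma integral; the substitution of
  \<open>c * y\<close> for \<open>y\<close> gives the general case.\<close>

lemma laplace_power_real:
  fixes a :: complex and c :: real
  assumes a: "Re a > 0" and c: "c > 0"
  shows "set_integrable lborel {0<..} (\<lambda>y. of_real y powr (a - 1) * exp (- (of_real c * of_real y)))"
    and "(LINT y:{0<..}|lborel. of_real y powr (a - 1) * exp (- (of_real c * of_real y)))
           = Gamma a * of_real c powr (-a)"
proof -
  let ?f = "\<lambda>c y. of_real y powr (a - 1) * exp (- (complex_of_real c * of_real y))"
  have int: "set_integrable lborel {0<..} (?f c)" if "c > 0" for c :: real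
  proof -
    have eq: "(\<lambda>t. complex_of_real t powr (a - 1) / of_real (exp (c * t))) = ?f c"
      by (auto simp: fun_eq_iff exp_minus divide_simps simp flip: exp_of_real)
    \<comment> \<open>The Gamma integral is available over the completed Lebesgue measure; Borel
      measurability of the integrand brings it back to \<open>lborel\<close>.\<close>
    have "integrable (completion lborel) (\<lambda>y. indicat_real {0<..} y *\<^sub>R ?f c y)"
      using absolutely_integrable_Gamma_integral[OF a that] unfolding eq set_integrable_def .
    moreover have "(\<lambda>y. indicat_real {0<..} y *\<^sub>R ?f c y) \<in> borel_measurable lborel"
      unfolding measurable_lborel2
      by (intro borel_measurable_continuous_on_indicator) (auto intro!: continuous_intros)
    ultimately show ?thesis
      unfolding set_integrable_def using integrable_completion by blast
  qed
  then show "set_integrable lborel {0<..} (?f c)" using c by blast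
  have "(LINT y:{0<..}|lborel. ?f 1 y) = Gamma a"
  proof -
    have "(LINT y:{0<..}|lborel. ?f 1 y) = integral {0<..} (?f 1)"
      by (rule set_borel_integral_eq_integral) (use int[of 1] in simp)
    also have "\<dots> = Gamma a"
      using Gamma_integral_complex'[OF a] by (intro integral_unique) (simp add: exp_minus divide_simps exp_of_real)
    finally show ?thesis .
  qed
  moreover have "(LINT y:{0<..}|lborel. ?f 1 y) = of_real c powr a * (LINT y:{0<..}|lborel. ?f c y)"
  proof -
    have "(LINT y:{0<..}|lborel. ?f 1 y) = c *\<^sub>R (LINT y|lborel. indicator {0<..} (0 + c * y) *\<^sub>R ?f 1 (0 + c * y))"
      unfolding set_lebesgue_integral_def using c
      by (subst lborel_integral_real_affine[of c _ 0]) auto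
    also have "\<dots> = c *\<^sub>R (LINT y:{0<..}|lborel. of_real c powr (a - 1) * ?f c y)"
      unfolding set_lebesgue_integral_def using c
      by (intro arg_cong[where f = "(*\<^sub>R) c"] Bochner_Integration.integral_cong)
         (auto simp: indicator_def zero_less_mult_iff powr_times_real)
    also have "\<dots> = of_real c * of_real c powr (a - 1) * (LINT y:{0<..}|lborel. ?f c y)"
      by (simp add: scaleR_conv_of_real)
    also have "of_real c * complex_of_real c powr (a - 1) = of_real c powr a"
      using c by (simp add: powr_diff)
    finally show ?thesis .
  qed
  ultimately show "(LINT y:{0<..}|lborel. ?f c y) = Gamma a * of_real c powr (-a)"
    using c by (simp add: powr_minus divide_simps mult.commute)
qed

text \<open>The norm of \<open>exp (- (s * y))\<close> depends only on \<open>Re s\<close>, so the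
  real case with \<open>c = Re s\<close> is a majorant.\<close>

lemma laplace_power_integrable:
  fixes a s :: complex
  assumes a: "Re a > 0" and s: "Re s > 0"
  shows "set_integrable lborel {0<..} (\<lambda>y. of_real y powr (a - 1) * exp (- (s * of_real y)))"
proof (rule set_integrable_bound[OF laplace_power_real(1)[OF a s]])
  show "set_borel_measurable lborel {0<..} (\<lambda>y. of_real y powr (a - 1) * exp (- (s * complex_of_real y)))"
    unfolding set_borel_measurable_def measurable_lborel2
    by (intro borel_measurable_continuous_on_indicator) (auto intro!: continuous_intros)
qed (auto simp: norm_mult)

text \<open>Taking norms replaces \<open>a\<close> and \<open>s\<close> by their real parts. The
  exact value serves to sum the norms of the terms when the Bessel-Clifford series is integrated
  termwise.\<close>

lemma norm_laplace_power:
  fixes a s :: complex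
  assumes a: "Re a > 0" and s: "Re s > 0"
  shows "(LINT y|lborel. norm (indicator {0<..} y *\<^sub>R (of_real y powr (a - 1) * exp (- (s * of_real y)))))
    = Gamma (Re a) * Re s powr (- Re a)"
proof -
  have "complex_of_real (LINT y|lborel. norm (indicator {0<..} y *\<^sub>R (of_real y powr (a - 1) * exp (- (s * of_real y)))))
     = (LINT y:{0<..}|lborel. of_real y powr (of_real (Re a) - 1) * exp (- (of_real (Re s) * of_real y)))"
    unfolding set_lebesgue_integral_def integral_complex_of_real[symmetric]
    by (intro Bochner_Integration.integral_cong)
       (auto simp: indicator_def norm_mult norm_powr_real_powr powr_of_real[symmetric] simp flip: exp_of_real)
  also have "\<dots> = Gamma (of_real (Re a)) * of_real (Re s) powr (- of_real (Re a))"
    by (rule laplace_power_real) (use a s in auto)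
  also have "\<dots> = of_real (Gamma (Re a) * Re s powr (- Re a))"
    using s by (simp add: Gamma_complex_of_real powr_of_real flip: of_real_minus)
  finally show ?thesis by (simp only: of_real_eq_iff)
qed

text \<open>
  A complex \<open>s\<close> in the right half plane lies in a disc around a large real \<open>c\<close> that avoids \<open>0\<close>;
  expanding \<open>exp (- (s - c) y)\<close> reduces the claim to real \<open>c\<close> and the binomial series.
\<close>

lemma laplace_power:
  fixes a s :: complex
  assumes a: "Re a > 0" and s: "Re s > 0"
  shows "(LINT y:{0<..}|lborel. of_real y powr (a - 1) * exp (- (s * of_real y))) = Gamma a * s powr (-a)"
proof -
  \<comment> \<open>The inequality \<open>norm (s - c) < c\<close> amounts to
    \<open>(norm s)\<^sup>2 < 2 * c * Re s\<close>; the added 1 makes it strict.\<close>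
  define c where "c = (norm s)\<^sup>2 / (2 * Re s) + 1"
  define w where "w = s - of_real c"
  have c: "c > 0" unfolding c_def using s by (simp add: add_nonneg_pos)
  have "(norm s)\<^sup>2 < 2 * c * Re s"
    using s by (simp add: c_def field_simps)
  moreover have "(norm w)\<^sup>2 = (norm s)\<^sup>2 - 2 * c * Re s + c\<^sup>2"
    unfolding cmod_power2 by (simp add: w_def power2_eq_square algebra_simps)
  ultimately have "(norm w)\<^sup>2 < c\<^sup>2" by simp
  then have w: "norm w < c"
    using c power2_less_imp_less[of "norm w" c] by simp
  let ?g = "\<lambda>y. complex_of_real y powr (a - 1) * exp (- (of_real c * of_real y))"
  let ?t = "\<lambda>k y. ?g y * ((- w) ^ k / fact k * of_real y ^ k)"
  have t_eq: "indicator {0<..} y *\<^sub>R ?t k y = (- w) ^ k / fact k *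
      (indicator {0<..} y *\<^sub>R (of_real y powr (a + of_nat k - 1) * exp (- (of_real c * of_real y))))" for k y
    by (cases "y > 0") (simp_all add: powr_add powr_diff mult_ac)
  have a': "Re (a + of_nat k) > 0" for k using a by simp
  have t_int: "integrable lborel (\<lambda>y. indicator {0<..} y *\<^sub>R ?t k y)" for k
    unfolding t_eq by (intro integrable_mult_right laplace_power_real(1)[OF a' c, unfolded set_integrable_def])
  \<comment> \<open>The factor \<open>Gamma (a + k)\<close> contributes a Pochhammer symbol, and
    \<open>(-1) ^ k * pochhammer a k / fact k\<close> is the binomial coefficient of
    \<open>- a\<close> over \<open>k\<close>.\<close>
  have t_val: "(LINT y|lborel. indicator {0<..} y *\<^sub>R ?t k y)
      = Gamma a * of_real c powr (-a) * (((-a) gchoose k) * (w / of_real c) ^ k)" for k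
  proof -
    have "a \<notin> \<int>\<^sub>\<le>\<^sub>0" using a by (auto elim!: nonpos_Ints_cases)
    then have "Gamma (a + of_nat k) = pochhammer a k * Gamma a"
      by (simp add: pochhammer_Gamma Gamma_eq_zero_iff)
    moreover have "of_real c powr (- (a + of_nat k)) = of_real c powr (-a) / of_real c ^ k"
      using c by (simp add: powr_diff)
    ultimately show ?thesis
      unfolding t_eq integral_mult_right_zero
        laplace_power_real(2)[OF a' c, of k, unfolded set_lebesgue_integral_def]
      by (simp add: gbinomial_pochhammer power_divide power_minus[of w])
  qed
  \<comment> \<open>Every partial sum of the exponential series of \<open>- w * y\<close> is bounded
    by \<open>exp (norm w * y)\<close>, so the integrands have a majorant with decay rate
    \<open>c - norm w\<close>, which is positive by the choice of \<open>c\<close>.\<close>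
  have "(\<lambda>n. LINT y|lborel. (\<Sum>k<n. indicator {0<..} y *\<^sub>R ?t k y)) \<longlonglongrightarrow>
      (LINT y|lborel. indicator {0<..} y *\<^sub>R (of_real y powr (a - 1) * exp (- (s * of_real y))))"
  proof (rule integral_dominated_convergence)
    show "integrable lborel (\<lambda>y. norm (indicator {0<..} y *\<^sub>R (of_real y powr (a - 1) * exp (- (of_real (c - norm w) * of_real y)))))"
      using laplace_power_real(1)[OF a, of "c - norm w"] w unfolding set_integrable_def by (intro integrable_norm) auto
    show "(\<lambda>y. \<Sum>k<n. indicator {0<..} y *\<^sub>R ?t k y) \<in> borel_measurable lborel" for n
      using t_int by (intro borel_measurable_sum) (blast dest: borel_measurable_integrable)
    show "(\<lambda>y. indicator {0<..} y *\<^sub>R (of_real y powr (a - 1) * exp (- (s * of_real y)))) \<in> borel_measurable lborel"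
      using laplace_power_integrable[OF a s] unfolding set_integrable_def by (rule borel_measurable_integrable)
    show "AE y in lborel. (\<lambda>n. \<Sum>k<n. indicator {0<..} y *\<^sub>R ?t k y) \<longlonglongrightarrow>
        indicator {0<..} y *\<^sub>R (of_real y powr (a - 1) * exp (- (s * of_real y)))"
    proof (intro AE_I2)
      fix y :: real
      have "(\<lambda>k. (- w * of_real y) ^ k /\<^sub>R fact k) sums exp (- w * of_real y)"
        by (rule exp_converges)
      from sums_mult[OF this, of "indicator {0<..} y *\<^sub>R ?g y"]
      have "(\<lambda>k. indicator {0<..} y *\<^sub>R ?g y * ((- w * of_real y) ^ k /\<^sub>R fact k))
          sums (indicator {0<..} y *\<^sub>R ?g y * exp (- w * of_real y))" .
      moreover have "indicator {0<..} y *\<^sub>R ?g y * ((- w * of_real y) ^ k /\<^sub>R fact k)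
          = indicator {0<..} y *\<^sub>R ?t k y" for k
        unfolding power_mult_distrib by (simp add: scaleR_conv_of_real divide_inverse mult_ac)
      ultimately have "(\<lambda>k. indicator {0<..} y *\<^sub>R ?t k y) sums (indicator {0<..} y *\<^sub>R ?g y * exp (- w * of_real y))"
        by simp
      also have "indicator {0<..} y *\<^sub>R ?g y * exp (- w * of_real y)
          = indicator {0<..} y *\<^sub>R (of_real y powr (a - 1) * exp (- (s * of_real y)))"
        by (simp add: w_def exp_add[symmetric] algebra_simps flip: exp_diff)
      finally show "(\<lambda>n. \<Sum>k<n. indicator {0<..} y *\<^sub>R ?t k y) \<longlonglongrightarrow> \<dots>"
        by (simp add: sums_def)
    qed
    show "AE y in lborel. norm (\<Sum>k<n. indicator {0<..} y *\<^sub>R ?t k y) \<le>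
       norm (indicator {0<..} y *\<^sub>R (of_real y powr (a - 1) * exp (- (of_real (c - norm w) * of_real y))))" for n
    proof (intro AE_I2)
      fix y :: real
      have "norm (\<Sum>k<n. ?t k y) \<le> norm (of_real y powr (a - 1) * exp (- (of_real (c - norm w) * of_real y)))" if y: "y > 0"
      proof -
        have "norm (\<Sum>k<n. (- w) ^ k / fact k * of_real y ^ k) \<le> (\<Sum>k<n. (norm w * y) ^ k /\<^sub>R fact k)"
          using y by (intro order_trans[OF norm_sum] sum_mono)
            (simp add: norm_mult norm_divide norm_power power_mult_distrib divide_simps)
        also have "\<dots> \<le> exp (norm w * y)"
          unfolding exp_def using y summable_exp_generic[of "norm w * y"] by (intro sum_le_suminf) auto
        finally have "norm (?g y) * norm (\<Sum>k<n. (- w) ^ k / fact k * of_real y ^ k) \<le> norm (?g y) * exp (norm w * y)"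
          by (rule mult_left_mono) simp
        also have "\<dots> = norm (of_real y powr (a - 1) * exp (- (of_real (c - norm w) * of_real y)))"
          by (simp add: norm_mult algebra_simps flip: exp_add exp_diff)
        finally show ?thesis by (simp only: norm_mult[symmetric] sum_distrib_left)
      qed
      then show "norm (\<Sum>k<n. indicator {0<..} y *\<^sub>R ?t k y) \<le>
         norm (indicator {0<..} y *\<^sub>R (of_real y powr (a - 1) * exp (- (of_real (c - norm w) * of_real y))))"
        by (cases "y > 0") auto
    qed
  qed
  moreover have "(LINT y|lborel. (\<Sum>k<n. indicator {0<..} y *\<^sub>R ?t k y))
      = (\<Sum>k<n. Gamma a * of_real c powr (-a) * (((-a) gchoose k) * (w / of_real c) ^ k))" for n
    by (subst Bochner_Integration.integral_sum) (auto intro: t_int simp only: t_val)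
  moreover have "(\<lambda>k. Gamma a * of_real c powr (-a) * (((-a) gchoose k) * (w / of_real c) ^ k)) sums
     (Gamma a * of_real c powr (-a) * (1 + w / of_real c) powr (-a))"
    using w c by (intro sums_mult gen_binomial_complex) (simp add: norm_divide)
  \<comment> \<open>The principal powers multiply because one of the bases is a positive
    real.\<close>
  moreover have "of_real c powr (-a) * (1 + w / of_real c) powr (-a) = s powr (-a)"
    using c by (simp add: w_def field_simps flip: powr_times_real_left)
  ultimately show ?thesis
    unfolding sums_def set_lebesgue_integral_def by (simp add: LIMSEQ_unique mult.assoc)
qed

text \<open>Integrating the k-th term yields \<open>Gamma (\<nu> + 1 + k)\<close>, which cancels the
  reciprocal Gamma in \<open>bc_coeff\<close>; what remains is the exponential series of
  \<open>- x / s\<close>.\<close>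

lemma laplace_bessel_clifford:
  assumes \<nu>: "Re \<nu> > -1" and s: "Re s > 0" and x: "x \<ge> 0"
  shows "(LINT y:{0<..}|lborel. of_real y powr \<nu> * exp (- (s * of_real y)) * bessel_clifford \<nu> (of_real (x * y)))
       = s powr (- \<nu> - 1) * exp (- (of_real x / s))"
proof -
  let ?p = "\<lambda>k y. indicator {0<..} y *\<^sub>R (of_real y powr (\<nu> + 1 + of_nat k - 1) * exp (- (s * complex_of_real y)))"
  let ?t = "\<lambda>k y. bc_coeff \<nu> k * of_real x ^ k * ?p k y"
  have a: "Re (\<nu> + 1 + of_nat k) > 0" for k using \<nu> by simp
  have t_eq: "?t k y = indicator {0<..} y *\<^sub>R (of_real y powr \<nu> * exp (- (s * of_real y))) *
      (bc_coeff \<nu> k * of_real (x * y) ^ k)" for k y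
    by (cases "y > 0") (simp_all add: powr_add power_mult_distrib mult_ac)
  have int: "integrable lborel (?t k)" for k
    using laplace_power_integrable[OF a s, of k] unfolding set_integrable_def by (rule integrable_mult_right)
  have val: "(LINT y|lborel. ?t k y) = s powr (- \<nu> - 1) * ((- of_real x / s) ^ k /\<^sub>R fact k)" for k
  proof -
    have "\<nu> + 1 + of_nat k \<notin> \<int>\<^sub>\<le>\<^sub>0"
      using a[of k] complex_Re_of_int by (metis nonpos_Ints_cases not_less of_int_0_less_iff)
    then have "rGamma (of_nat k + \<nu> + 1) \<noteq> 0"
      by (simp add: rGamma_eq_zero_iff add_ac)
    then have "rGamma (of_nat k + \<nu> + 1) * Gamma (\<nu> + 1 + of_nat k) = 1"
      by (simp add: Gamma_def add_ac)
    then have "bc_coeff \<nu> k * Gamma (\<nu> + 1 + of_nat k) = (-1) ^ k / fact k"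
      by (simp add: bc_coeff_def mult.assoc)
    moreover have "s powr (- (\<nu> + 1 + of_nat k)) = s powr (- \<nu> - 1) / s ^ k"
    proof -
      have "s \<noteq> 0" using s by auto
      then have "s powr (- \<nu> - 1 - of_nat k) = s powr (- \<nu> - 1) / s ^ k"
        by (simp add: powr_diff[of s "- \<nu> - 1"])
      moreover have "- (\<nu> + 1 + of_nat k) = - \<nu> - 1 - of_nat k" by simp
      ultimately show ?thesis by simp
    qed
    moreover have "bc_coeff \<nu> k * of_real x ^ k * (Gamma (\<nu> + 1 + of_nat k) * s powr (- (\<nu> + 1 + of_nat k)))
       = (bc_coeff \<nu> k * Gamma (\<nu> + 1 + of_nat k)) * of_real x ^ k * s powr (- (\<nu> + 1 + of_nat k))"
      by (simp only: mult_ac)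
    ultimately have "bc_coeff \<nu> k * of_real x ^ k * (Gamma (\<nu> + 1 + of_nat k) * s powr (- (\<nu> + 1 + of_nat k)))
       = (-1) ^ k / fact k * of_real x ^ k * (s powr (- \<nu> - 1) / s ^ k)"
      by simp
    also have "\<dots> = s powr (- \<nu> - 1) * ((- of_real x / s) ^ k /\<^sub>R fact k)"
      unfolding power_divide power_minus[of "of_real x"]
      by (simp add: scaleR_conv_of_real divide_inverse mult_ac)
    finally show ?thesis
      unfolding integral_mult_right_zero laplace_power[OF a s, of k, unfolded set_lebesgue_integral_def] .
  qed
  \<comment> \<open>The interchange of sum and integral needs the sum of the integrated norms. After
    the Pochhammer factors cancel it is dominated by a multiple of the exponential series of
    \<open>x / Re s\<close>.\<close>
  have "summable (\<lambda>k. LINT y|lborel. norm (?t k y))"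
  proof (rule summable_comparison_test)
    let ?K = "norm (rGamma (\<nu> + 1)) * Gamma (Re \<nu> + 1) * Re s powr (- (Re \<nu> + 1))"
    show "summable (\<lambda>k. ?K * ((x / Re s) ^ k /\<^sub>R fact k))"
      by (intro summable_mult summable_exp_generic)
    have "norm (LINT y|lborel. norm (?t k y)) \<le> ?K * ((x / Re s) ^ k /\<^sub>R fact k)" for k
    proof -
      have p: "pochhammer (Re \<nu> + 1) k > 0" using \<nu> by (intro pochhammer_pos) simp
      have "Re \<nu> + 1 \<notin> \<int>\<^sub>\<le>\<^sub>0" using \<nu> by (auto elim!: nonpos_Ints_cases)
      then have G: "Gamma (Re \<nu> + 1 + real k) = pochhammer (Re \<nu> + 1) k * Gamma (Re \<nu> + 1)"
        by (simp add: pochhammer_Gamma Gamma_eq_zero_iff)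
      have P: "Re s powr (- (Re \<nu> + 1 + real k)) = Re s powr (- (Re \<nu> + 1)) / Re s ^ k"
        using powr_diff[of "Re s" "- (Re \<nu> + 1)" "real k"] powr_realpow[OF s, of k] by (simp add: algebra_simps)
      have "norm (LINT y|lborel. norm (?t k y)) = (LINT y|lborel. norm (?t k y))"
        by (simp add: integral_nonneg)
      also have "\<dots> = norm (bc_coeff \<nu> k) * x ^ k * (LINT y|lborel. norm (?p k y))"
        unfolding norm_mult[of "bc_coeff \<nu> k * of_real x ^ k"] integral_mult_right_zero
        using x by (simp add: norm_mult norm_power)
      also have "(LINT y|lborel. norm (?p k y)) = Gamma (Re \<nu> + 1 + real k) * Re s powr (- (Re \<nu> + 1 + real k))"
        using norm_laplace_power[OF a s, of k] by simp
      also have "norm (bc_coeff \<nu> k) * x ^ k * \<dots> \<le>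
          norm (rGamma (\<nu> + 1)) / pochhammer (Re \<nu> + 1) k / fact k * x ^ k * \<dots>"
        using x \<nu> s by (intro mult_right_mono norm_bc_coeff_le mult_nonneg_nonneg) (auto simp: Gamma_real_pos less_imp_le)
      also have "\<dots> = ?K * ((x / Re s) ^ k /\<^sub>R fact k)"
        unfolding G P using p by (simp add: divide_simps power_divide)
      finally show ?thesis .
    qed
    then show "\<exists>N. \<forall>k\<ge>N. norm (LINT y|lborel. norm (?t k y)) \<le> ?K * ((x / Re s) ^ k /\<^sub>R fact k)"
      by blast
  qed
  moreover have "AE y in lborel. summable (\<lambda>k. norm (?t k y))"
    unfolding t_eq norm_mult[of "indicator _ _ *\<^sub>R _"] by (intro AE_I2 summable_mult summable_norm_bc \<nu>)
  ultimately have "(LINT y|lborel. (\<Sum>k. ?t k y)) = (\<Sum>k. LINT y|lborel. ?t k y)"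
    using int by (intro integral_suminf)
  also have "\<dots> = s powr (- \<nu> - 1) * exp (- of_real x / s)"
    unfolding val suminf_mult[OF summable_exp_generic] by (simp add: exp_def)
  also have "(LINT y|lborel. (\<Sum>k. ?t k y)) =
    (LINT y:{0<..}|lborel. of_real y powr \<nu> * exp (- (s * of_real y)) * bessel_clifford \<nu> (of_real (x * y)))"
    unfolding t_eq suminf_mult[OF summable_bc[OF \<nu>]] set_lebesgue_integral_def bessel_clifford_def by simp
  finally show ?thesis by simp
qed

section \<open>Rapidly decreasing functions and the Hankel transform\<close>

text \<open>Smoothness is left out so that \<open>hankel_core\<close> can be shown to qualify by
  estimates alone. Measurability is asked only after restriction to positive arguments, and the
  weight \<open>1 + x\<close> includes boundedness near 0.\<close>

definition rapid_decay :: "(real \<Rightarrow> complex) \<Rightarrow> bool" where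
  "rapid_decay \<phi> \<longleftrightarrow> (\<lambda>x. indicator {0<..} x *\<^sub>R \<phi> x) \<in> borel_measurable borel \<and>
     (\<forall>k. \<exists>C. \<forall>x>0. (1 + x) ^ k * norm (\<phi> x) \<le> C)"

lemma rapid_decayE:
  assumes "rapid_decay \<phi>"
  obtains C where "C \<ge> 0" "\<And>x. x > 0 \<Longrightarrow> norm (\<phi> x) \<le> C / (1 + x) ^ k"
proof -
  obtain C where C: "\<And>x. x > 0 \<Longrightarrow> (1 + x) ^ k * norm (\<phi> x) \<le> C"
    using assms unfolding rapid_decay_def by blast
  have "0 \<le> (1 + 1) ^ k * norm (\<phi> 1)" by simp
  also have "\<dots> \<le> C" by (rule C) simp
  finally have "C \<ge> 0" .
  moreover have "norm (\<phi> x) \<le> C / (1 + x) ^ k" if "x > 0" for x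
    using C[OF that] that by (simp add: field_simps)
  ultimately show thesis using that by blast
qed

text \<open>Polynomial growth of degree \<open>p\<close> is absorbed by using the decay of the first
  factor with exponent \<open>k + p\<close>.\<close>

lemma rapid_decay_mult:
  assumes \<phi>: "rapid_decay \<phi>" and "continuous_on {0<..} \<psi>"
    and \<psi>: "\<And>x. x > 0 \<Longrightarrow> norm (\<psi> x) \<le> K * (1 + x) ^ p"
  shows "rapid_decay (\<lambda>x. \<phi> x * \<psi> x)"
  unfolding rapid_decay_def
proof (intro conjI allI)
  have "(\<lambda>x. (indicator {0<..} x *\<^sub>R \<phi> x) * (indicator {0<..} x *\<^sub>R \<psi> x)) \<in> borel_measurable borel"
  proof (rule borel_measurable_times)
    show "(\<lambda>x. indicator {0<..} x *\<^sub>R \<psi> x) \<in> borel_measurable borel"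
      using assms(2) by (intro borel_measurable_continuous_on_indicator) auto
  qed (use \<phi> in \<open>simp add: rapid_decay_def\<close>)
  also have "(\<lambda>x. (indicator {0<..} x *\<^sub>R \<phi> x) * (indicator {0<..} x *\<^sub>R \<psi> x)) = (\<lambda>x. indicator {0<..} x *\<^sub>R (\<phi> x * \<psi> x))"
    by (auto simp: indicator_def)
  finally show "\<dots> \<in> borel_measurable borel" .
next
  fix k
  obtain C where C: "C \<ge> 0" "\<And>x. x > 0 \<Longrightarrow> norm (\<phi> x) \<le> C / (1 + x) ^ (k + p)"
    using rapid_decayE[OF \<phi>] by blast
  have "(1 + x) ^ k * norm (\<phi> x * \<psi> x) \<le> C * K" if x: "x > 0" for x
  proof -
    have "norm (\<phi> x * \<psi> x) \<le> C / (1 + x) ^ (k + p) * (K * (1 + x) ^ p)"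
      unfolding norm_mult using C x by (intro mult_mono \<psi>) auto
    also have "\<dots> = C * K / (1 + x) ^ k"
      using x by (simp add: power_add)
    finally show ?thesis using x by (simp add: field_simps)
  qed
  then show "\<exists>C. \<forall>x>0. (1 + x) ^ k * norm (\<phi> x * \<psi> x) \<le> C" by blast
qed

text \<open>The half line is cut at 1: below, \<open>x powr a\<close> is an integrable majorant
  because \<open>a > -1\<close>; above, \<open>x powr (-2)\<close> is one because
  \<open>N \<ge> a + 2\<close>.\<close>

lemma set_integrable_powr_weight:
  fixes a :: real
  assumes "a > -1" "real N \<ge> a + 2"
  shows "set_integrable lborel {0<..} (\<lambda>x. x powr a / (1 + x) ^ N)"
proof -
  let ?f = "\<lambda>x::real. x powr a / (1 + x) ^ N"
  have meas: "set_borel_measurable lborel A ?f" if "A \<in> sets borel" "A \<subseteq> {0<..}" for A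
    unfolding set_borel_measurable_def measurable_lborel2
    using that by (intro borel_measurable_continuous_on_indicator) (auto intro!: continuous_intros dest: subsetD)
  have lebesgue_to_borel: "set_integrable lborel A (\<lambda>x. x powr e)"
    if "(\<lambda>x. x powr e) integrable_on A" "A \<in> sets borel" "A \<subseteq> {0<..}" for A and e :: real
  proof -
    have "(\<lambda>x. x powr e) absolutely_integrable_on A"
      using that by (intro nonnegative_absolutely_integrable_1) auto
    moreover have "(\<lambda>x. indicator A x *\<^sub>R x powr e) \<in> borel_measurable lborel"
      unfolding measurable_lborel2
      using that by (intro borel_measurable_continuous_on_indicator) (auto intro!: continuous_intros dest: subsetD)
    ultimately show ?thesis
      unfolding set_integrable_def using integrable_completion by blast
  qed
  have "set_integrable lborel {0<..1} ?f"
  proof (rule set_integrable_bound)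
    show "set_integrable lborel {0<..1} (\<lambda>x. x powr a)"
      using assms by (intro lebesgue_to_borel integrable_on_powr_from_0') auto
    have "x powr a / (1 + x) ^ N \<le> x powr a / 1" if "x > 0" for x :: real
      using that by (intro divide_left_mono one_le_power) auto
    then show "AE x in lborel. x \<in> {0<..1} \<longrightarrow> norm (?f x) \<le> norm (x powr a)"
      by (intro AE_I2) auto
  qed (rule meas; auto)
  moreover have "set_integrable lborel {1..} ?f"
  proof (rule set_integrable_bound)
    have "(\<lambda>x::real. x powr (-2)) integrable_on {1..}"
      using has_integral_powr_to_inf[of "-2" 1] by (auto simp: integrable_on_def)
    then show "set_integrable lborel {1..} (\<lambda>x::real. x powr (-2))"
      by (rule lebesgue_to_borel) auto
    have "x powr a / (1 + x) ^ N \<le> x powr (-2)" if x: "x \<ge> 1" for x :: real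
    proof -
      have "x powr a \<le> x powr (real N - 2)" using assms x by (intro powr_mono) auto
      also have "\<dots> = x powr (-2) * x ^ N"
        using x by (simp add: powr_diff powr_realpow powr_minus divide_simps)
      also have "\<dots> \<le> x powr (-2) * (1 + x) ^ N"
        using x by (intro mult_left_mono power_mono) auto
      finally show ?thesis using x by (simp add: field_simps)
    qed
    then show "AE x in lborel. x \<in> {1..} \<longrightarrow> norm (?f x) \<le> norm (x powr (-2))"
      by (intro AE_I2) auto
  qed (rule meas; auto)
  ultimately have "set_integrable lborel ({0<..1} \<union> {1..}) ?f"
    by (rule set_integrable_Un) auto
  also have "{0<..1} \<union> {1..} = {0::real<..}" by auto
  finally show ?thesis .
qed

lemma rapid_decay_set_integrable:
  assumes \<mu>: "Re \<mu> > -1" and \<phi>: "rapid_decay \<phi>"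
  shows "set_integrable lborel {0<..} (\<lambda>x. of_real x powr \<mu> * \<phi> x)"
proof -
  obtain N :: nat where N: "real N \<ge> Re \<mu> + 2" using real_arch_simple by blast
  obtain C where C: "C \<ge> 0" "\<And>x. x > 0 \<Longrightarrow> norm (\<phi> x) \<le> C / (1 + x) ^ N"
    using rapid_decayE[OF \<phi>] by blast
  show ?thesis
  proof (rule set_integrable_bound)
    show "set_integrable lborel {0<..} (\<lambda>x. C * (x powr Re \<mu> / (1 + x) ^ N))"
      by (intro set_integrable_mult_right set_integrable_powr_weight \<mu> N)
    have "(\<lambda>x. (indicator {0<..} x *\<^sub>R (complex_of_real x powr \<mu>)) * (indicator {0<..} x *\<^sub>R \<phi> x)) \<in> borel_measurable borel"
    proof (rule borel_measurable_times)
      show "(\<lambda>x. indicator {0<..} x *\<^sub>R complex_of_real x powr \<mu>) \<in> borel_measurable borel"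
        by (intro borel_measurable_continuous_on_indicator) (auto intro!: continuous_intros)
    qed (use \<phi> in \<open>simp add: rapid_decay_def\<close>)
    also have "(\<lambda>x. (indicator {0<..} x *\<^sub>R (complex_of_real x powr \<mu>)) * (indicator {0<..} x *\<^sub>R \<phi> x)) =
        (\<lambda>x. indicator {0<..} x *\<^sub>R (of_real x powr \<mu> * \<phi> x))"
      by (auto simp: indicator_def)
    finally show "set_borel_measurable lborel {0<..} (\<lambda>x. of_real x powr \<mu> * \<phi> x)"
      by (simp add: set_borel_measurable_def)
    have "norm (of_real x powr \<mu> * \<phi> x) \<le> C * (x powr Re \<mu> / (1 + x) ^ N)" if "x > 0" for x
      using mult_left_mono[OF C(2)[OF that], of "x powr Re \<mu>"] that
      by (simp add: norm_mult norm_powr_real_powr mult_ac)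
    then show "AE x in lborel. x \<in> {0<..} \<longrightarrow> norm (of_real x powr \<mu> * \<phi> x) \<le> norm (C * (x powr Re \<mu> / (1 + x) ^ N))"
      using C(1) by (intro AE_I2) auto
  qed
qed

section \<open>Schwartz functions on the half line and integration by parts\<close>

lemma half_line_deriv_has_vector_derivative:
  assumes "f \<in> schwartz_half_line" "x > 0"
  shows "(half_line_deriv n f has_vector_derivative half_line_deriv (Suc n) f x) (at x)"
proof -
  have "half_line_deriv n f differentiable (at x within {0..})"
    using assms by (auto simp: schwartz_half_line_def differentiable_on_def)
  then have "(half_line_deriv n f has_vector_derivative half_line_deriv (Suc n) f x) (at x within {0..})"
    by (simp add: vector_derivative_works half_line_deriv_def)
  moreover have "at x within {0..} = at x"
    using assms(2) by (intro at_within_interior) auto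
  ultimately show ?thesis by simp
qed

lemma continuous_on_half_line_deriv:
  "f \<in> schwartz_half_line \<Longrightarrow> continuous_on {0..} (half_line_deriv n f)"
  by (auto simp: schwartz_half_line_def intro: differentiable_imp_continuous_on)

lemma rapid_decay_half_line_deriv:
  assumes f: "f \<in> schwartz_half_line"
  shows "rapid_decay (half_line_deriv n f)"
  unfolding rapid_decay_def
proof (intro conjI allI)
  show "(\<lambda>x. indicat_real {0<..} x *\<^sub>R half_line_deriv n f x) \<in> borel_measurable borel"
    by (intro borel_measurable_continuous_on_indicator
      continuous_on_subset[OF continuous_on_half_line_deriv[OF f]]) auto
next
  fix k
  have "((\<lambda>x. of_real (x ^ k) * half_line_deriv n f x) \<longlongrightarrow> 0) at_top"
    using f by (auto simp: schwartz_half_line_def)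
  then have "\<forall>\<^sub>F x in at_top. norm (of_real (x ^ k) * half_line_deriv n f x) < 1"
    using order_tendstoD(2)[OF tendsto_norm_zero, of _ _ 1] by simp
  then obtain X where X: "\<And>x. x \<ge> X \<Longrightarrow> norm (of_real (x ^ k) * half_line_deriv n f x) < 1"
    by (auto simp: eventually_at_top_linorder)
  \<comment> \<open>Up to \<open>Y\<close> the bound comes from compactness, with continuity at 0
    included; beyond it, \<open>Y \<ge> 1\<close> allows \<open>1 + x\<close> to be replaced by
    \<open>2 * x\<close>.\<close>
  define Y where "Y = max X 1"
  have "compact ((\<lambda>x. of_real ((1 + x) ^ k) * half_line_deriv n f x) ` {0..Y})"
    using continuous_on_subset[OF continuous_on_half_line_deriv[OF f], of "{0..Y}" n]
    by (intro compact_continuous_image continuous_intros) auto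
  from compact_imp_bounded[OF this] obtain B where
    "\<And>z. z \<in> (\<lambda>x. of_real ((1 + x) ^ k) * half_line_deriv n f x) ` {0..Y} \<Longrightarrow> norm z \<le> B"
    unfolding bounded_iff by blast
  then have B: "norm (of_real ((1 + x) ^ k) * half_line_deriv n f x) \<le> B" if "x \<in> {0..Y}" for x
    using that by blast
  have "(1 + x) ^ k * norm (half_line_deriv n f x) \<le> max B (2 ^ k)" if x: "x > 0" for x
  proof (cases "x \<le> Y")
    case True
    then have "\<bar>(1 + x) ^ k\<bar> * norm (half_line_deriv n f x) \<le> B"
      using B[of x] x unfolding norm_mult norm_of_real by simp
    then show ?thesis using x by simp
  next
    case False
    then have xX: "x \<ge> X" "x \<ge> 1" by (auto simp: Y_def)
    have "(1 + x) ^ k * norm (half_line_deriv n f x) \<le> (2 * x) ^ k * norm (half_line_deriv n f x)"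
      using xX by (intro mult_right_mono power_mono) auto
    also have "\<dots> = 2 ^ k * norm (of_real (x ^ k) * half_line_deriv n f x)"
      using x by (simp add: norm_mult norm_power power_mult_distrib)
    also have "\<dots> \<le> 2 ^ k * 1"
      using X[OF xX(1)] by (intro mult_left_mono) auto
    finally show ?thesis by simp
  qed
  then show "\<exists>C. \<forall>x>0. (1 + x) ^ k * norm (half_line_deriv n f x) \<le> C" by blast
qed

text \<open>The second factor grows at most linearly in \<open>x\<close>, since
  \<open>1 + x * y \<le> (1 + x) * (1 + y)\<close>.\<close>

lemma rapid_decay_mult_bessel_clifford:
  assumes "rapid_decay \<phi>" "Re \<mu> > -1" "y \<ge> 0"
  shows "rapid_decay (\<lambda>x. \<phi> x * bessel_clifford \<mu> (of_real (x * y)))"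
proof -
  obtain C where C: "C \<ge> 0" "\<And>t. t \<ge> 0 \<Longrightarrow> norm (bessel_clifford \<mu> (of_real t)) \<le> C * (1 + t)"
    using bessel_clifford_linear_bound[OF assms(2)] by blast
  have "norm (bessel_clifford \<mu> (of_real (x * y))) \<le> C * (1 + y) * (1 + x) ^ 1" if "x > 0" for x
  proof -
    have "norm (bessel_clifford \<mu> (of_real (x * y))) \<le> C * (1 + x * y)"
      using that assms by (intro C) auto
    also have "\<dots> \<le> C * ((1 + y) * (1 + x))"
      using that assms C(1) by (intro mult_left_mono) (auto simp: algebra_simps)
    finally show ?thesis by (simp add: mult_ac)
  qed
  then show ?thesis
    using assms by (intro rapid_decay_mult[OF assms(1), of _ "C * (1 + y)" 1]) (auto intro!: continuous_intros)
qed

text \<open>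
  Integration by parts with \<open>x\<^sup>\<mu> E\<^sub>\<mu>(x y)\<close> the \<open>x\<close>-derivative of \<open>x\<^sup>\<mu>\<^sup>+\<^sup>1 E\<^sub>\<mu>\<^sub>+\<^sub>1(x y)\<close>,
  where \<open>E\<^sub>\<mu>\<close> stands for \<^const>\<open>bessel_clifford\<close>.
\<close>

lemma bessel_clifford_integral_by_parts:
  assumes \<mu>: "Re \<mu> > -1" and y: "y > 0"
    and \<phi>: "rapid_decay \<phi>" and \<phi>': "rapid_decay \<phi>'" "continuous_on {0<..} \<phi>'"
    and deriv: "\<And>x. x > 0 \<Longrightarrow> (\<phi> has_vector_derivative \<phi>' x) (at x)"
  shows "(LINT x:{0<..}|lborel. of_real x powr \<mu> * (\<phi> x * bessel_clifford \<mu> (of_real (x * y))))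
    = - (LINT x:{0<..}|lborel. of_real x powr (\<mu> + 1) * (\<phi>' x * bessel_clifford (\<mu> + 1) (of_real (x * y))))"
proof -
  define E where "E = (\<lambda>(j::nat) (x::real). bessel_clifford (\<mu> + of_nat j) (of_real (x * y)))"
  define F where "F = (\<lambda>x. of_real x powr (\<mu> + 1) * (\<phi> x * E 1 x))"
  let ?f0 = "\<lambda>x. of_real x powr \<mu> * (\<phi> x * E 0 x)"
  let ?f1 = "\<lambda>x. of_real x powr (\<mu> + 1) * (\<phi>' x * E 1 x)"
  have rapid: "rapid_decay (\<lambda>x. \<psi> x * E j x)" if "rapid_decay \<psi>" for \<psi> j
    unfolding E_def using \<mu> y that by (intro rapid_decay_mult_bessel_clifford) auto
  have int0: "set_integrable lborel {0<..} ?f0"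
    by (intro rapid_decay_set_integrable rapid \<phi> \<mu>)
  have int1: "set_integrable lborel {0<..} ?f1"
    using \<mu> by (intro rapid_decay_set_integrable rapid \<phi>') auto
  have dF: "(F has_vector_derivative ?f0 x + ?f1 x) (at x)" if x: "x > 0" for x
  proof -
    have dp: "((\<lambda>x. of_real x powr (\<mu> + 1)) has_vector_derivative (\<mu> + 1) * of_real x powr \<mu>) (at x)"
    proof (rule has_vector_derivative_real_field)
      show "((\<lambda>z. z powr (\<mu> + 1)) has_field_derivative (\<mu> + 1) * of_real x powr \<mu>) (at (of_real x))"
        using has_field_derivative_powr[of "of_real x" "\<mu> + 1"] x by simp
    qed
    have dE: "(E 1 has_vector_derivative - of_real y * E 2 x) (at x)"
    proof -
      have "((\<lambda>z. bessel_clifford (\<mu> + 1) (z * of_real y)) has_field_derivative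
          - bessel_clifford (\<mu> + 1 + 1) (of_real x * of_real y) * of_real y) (at (of_real x))"
        by (rule DERIV_chain2[OF bessel_clifford_deriv])
          (use \<mu> in \<open>auto intro!: derivative_eq_intros\<close>)
      from has_vector_derivative_real_field[OF this] show ?thesis
        by (simp add: E_def[abs_def] add.assoc mult.commute)
    qed
    have "(F has_vector_derivative of_real x powr (\<mu> + 1) * (\<phi> x * (- of_real y * E 2 x) + \<phi>' x * E 1 x)
        + (\<mu> + 1) * of_real x powr \<mu> * (\<phi> x * E 1 x)) (at x)"
      unfolding F_def by (intro has_vector_derivative_mult dp dE deriv x)
    moreover have "of_real x powr (\<mu> + 1) * (\<phi> x * (- of_real y * E 2 x) + \<phi>' x * E 1 x)
        + (\<mu> + 1) * of_real x powr \<mu> * (\<phi> x * E 1 x) = ?f0 x + ?f1 x"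
    proof -
      \<comment> \<open>The recurrence merges the two terms that arise from differentiating the
        power and the Bessel-Clifford factor into \<open>?f0 x\<close>.\<close>
      have E0: "E 0 x = (\<mu> + 1) * E 1 x - of_real (x * y) * E 2 x"
        using bessel_clifford_recurrence[OF \<mu>, of "of_real (x * y)"] by (simp add: E_def)
      show ?thesis
        unfolding E0 using x by (simp add: powr_add algebra_simps)
    qed
    ultimately show ?thesis by simp
  qed
  have cont: "continuous_on {0<..} (\<lambda>x. ?f0 x + ?f1 x)"
  proof -
    have "continuous_on {0<..} \<phi>"
      using deriv by (intro continuous_at_imp_continuous_on) (blast intro: has_vector_derivative_continuous)
    then show ?thesis
      unfolding E_def using \<mu> \<phi>'(2) by (intro continuous_intros) auto
  qed
  \<comment> \<open>The exponent is left free because the two boundary limits use different values: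
    0 suffices at the origin, where \<open>Re \<mu> + 1 > 0\<close> gives the decay, and some
    \<open>N > Re \<mu> + 1\<close> is taken at infinity.\<close>
  have bound: "\<exists>C\<ge>0. \<forall>x>0. norm (F x) \<le> x powr (Re \<mu> + 1) * (C / (1 + x) ^ k)" for k
  proof -
    obtain C where C: "C \<ge> 0" "\<And>x. x > 0 \<Longrightarrow> norm (\<phi> x * E 1 x) \<le> C / (1 + x) ^ k"
      using rapid_decayE[OF rapid[OF \<phi>]] by blast
    then have "norm (F x) \<le> x powr (Re \<mu> + 1) * (C / (1 + x) ^ k)" if "x > 0" for x
      unfolding F_def norm_mult[of "_ powr _"] using that by (intro mult_mono) (auto simp: norm_powr_real_powr)
    with C(1) show ?thesis by blast
  qed
  have lim0: "(F \<longlongrightarrow> 0) (at_right 0)"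
  proof -
    obtain C where C: "C \<ge> 0" "\<And>x. x > 0 \<Longrightarrow> norm (F x) \<le> x powr (Re \<mu> + 1) * (C / (1 + x) ^ 0)"
      using bound[of 0] by blast
    have "((\<lambda>x. x powr (Re \<mu> + 1)) \<longlongrightarrow> 0) (at_right 0)"
      using \<mu> by (intro tendsto_zero_powrI[where b = "Re \<mu> + 1"])
        (auto intro!: tendsto_eq_intros eventually_mono[OF eventually_at_right_less[of 0]])
    then have lim: "((\<lambda>x. x powr (Re \<mu> + 1) * C) \<longlongrightarrow> 0) (at_right 0)"
      by (rule tendsto_mult_left_zero)
    show ?thesis
      using C(2) by (intro Lim_null_comparison[OF _ lim] eventually_mono[OF eventually_at_right_less[of 0]]) auto
  qed
  have lim_top: "(F \<longlongrightarrow> 0) at_top"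
  proof -
    obtain N :: nat where N: "real N > Re \<mu> + 1" using reals_Archimedean2 by blast
    obtain C where C: "C \<ge> 0" "\<And>x. x > 0 \<Longrightarrow> norm (F x) \<le> x powr (Re \<mu> + 1) * (C / (1 + x) ^ N)"
      using bound[of N] by blast
    have "((\<lambda>x. x powr (Re \<mu> + 1 - real N)) \<longlongrightarrow> 0) at_top"
      using N by (intro tendsto_neg_powr filterlim_ident) auto
    then have lim: "((\<lambda>x. x powr (Re \<mu> + 1 - real N) * C) \<longlongrightarrow> 0) at_top"
      by (rule tendsto_mult_left_zero)
    have "norm (F x) \<le> x powr (Re \<mu> + 1 - real N) * C" if x: "x > 0" for x
    proof -
      note C(2)[OF x]
      also have "x powr (Re \<mu> + 1) * (C / (1 + x) ^ N) \<le> x powr (Re \<mu> + 1) * (C / x ^ N)"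
        using x C(1) by (intro mult_left_mono divide_left_mono power_mono) auto
      also have "\<dots> = x powr (Re \<mu> + 1 - real N) * C"
        using x by (simp add: powr_diff powr_realpow)
      finally show ?thesis .
    qed
    then show ?thesis
      by (intro Lim_null_comparison[OF _ lim] eventually_mono[OF eventually_gt_at_top[of 0]])
  qed
  have int: "set_integrable lborel (einterval 0 \<infinity>) (\<lambda>x. ?f0 x + ?f1 x)"
    unfolding zero_ereal_def einterval_eq by (intro set_integral_add int0 int1)
  have "(LBINT x=0..\<infinity>. ?f0 x + ?f1 x) = 0 - 0"
  proof (rule interval_integral_FTC_integrable[where F = F])
    show "isCont (\<lambda>x. ?f0 x + ?f1 x) x" if "0 < ereal x" for x
      using cont that by (simp add: continuous_on_eq_continuous_at)
    show "((F \<circ> real_of_ereal) \<longlongrightarrow> 0) (at_right 0)"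
      using lim0 unfolding zero_ereal_def ereal_tendsto_simps .
    show "((F \<circ> real_of_ereal) \<longlongrightarrow> 0) (at_left \<infinity>)"
      using lim_top unfolding ereal_tendsto_simps .
  qed (use dF int in auto)
  then have "(LINT x:{0<..}|lborel. ?f0 x + ?f1 x) = 0"
    by (simp add: interval_lebesgue_integral_0_infty)
  then have "(LINT x:{0<..}|lborel. ?f0 x) + (LINT x:{0<..}|lborel. ?f1 x) = 0"
    by (subst (asm) set_integral_add(2)[OF int0 int1])
  then show ?thesis
    by (simp add: E_def add_eq_0_iff2)
qed

section \<open>The Hankel transform without its power factor, its decay and its Laplace
  transform\<close>

lemma borel_measurable_bessel_clifford:
  assumes "Re \<mu> > -1"
  shows "bessel_clifford \<mu> \<in> borel_measurable borel"
  by (intro borel_measurable_continuous_onI continuous_on_bessel_clifford[OF assms] continuous_on_id)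

text \<open>This is the function \<open>g\<close> of the introduction, with \<open>\<phi>\<close> in
  the place of \<open>f1\<close>. Order and function are both parameters because integration by
  parts changes both.\<close>

definition hankel_core :: "complex \<Rightarrow> (real \<Rightarrow> complex) \<Rightarrow> real \<Rightarrow> complex" where
  "hankel_core \<nu> \<phi> y = (LINT x:{0<..}|lborel. of_real x powr \<nu> * (\<phi> x * bessel_clifford \<nu> (of_real (x * y))))"

text \<open>Each integration by parts differentiates the function, raises the order by one and
  contributes a sign.\<close>

lemma hankel_core_half_line_deriv:
  assumes \<nu>: "Re \<nu> > -1" and f: "f \<in> schwartz_half_line" and y: "y > 0"
  shows "hankel_core \<nu> f y = (-1) ^ m * hankel_core (\<nu> + of_nat m) (half_line_deriv m f) y"
proof (induction m)
  case 0
  then show ?case by (simp add: half_line_deriv_def)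
next
  case (Suc m)
  have "hankel_core (\<nu> + of_nat m) (half_line_deriv m f) y = - hankel_core (\<nu> + of_nat m + 1) (half_line_deriv (Suc m) f) y"
    unfolding hankel_core_def
  proof (rule bessel_clifford_integral_by_parts)
    show "continuous_on {0<..} (half_line_deriv (Suc m) f)"
      by (rule continuous_on_subset[OF continuous_on_half_line_deriv[OF f]]) auto
  qed (use \<nu> f y in \<open>auto intro: rapid_decay_half_line_deriv half_line_deriv_has_vector_derivative\<close>)
  then show ?case
    using Suc by (simp add: add_ac)
qed

lemma hankel_core_decay:
  assumes \<nu>: "Re \<nu> > -1" and f: "f \<in> schwartz_half_line"
  shows "\<exists>C\<ge>0. \<forall>y>0. y ^ k * norm (hankel_core \<nu> f y) \<le> C"
proof -
  \<comment> \<open>From \<open>Re \<nu> > -1\<close> the order \<open>\<nu> + m\<close> has real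
    part above \<open>2 * k\<close>, as \<open>bessel_clifford_decay\<close> requires. Its bound
    \<open>C / (x * y) ^ k\<close> removes \<open>k\<close> powers of \<open>x\<close>, leaving the
    exponent \<open>\<nu> + (k + 1)\<close>, still integrable at 0.\<close>
  define m where "m = 2 * k + 1"
  let ?h = "half_line_deriv m f"
  obtain C where C: "C \<ge> 0" "\<And>t. t \<ge> 0 \<Longrightarrow> t ^ k * norm (bessel_clifford (\<nu> + of_nat m) (of_real t)) \<le> C"
    using bessel_clifford_decay[of k "\<nu> + of_nat m"] \<nu> by (auto simp: m_def)
  have int: "integrable lborel (\<lambda>x. norm (indicator {0<..} x *\<^sub>R (of_real x powr (\<nu> + of_nat (k + 1)) * ?h x)))"
    using rapid_decay_set_integrable[of "\<nu> + of_nat (k + 1)" ?h] rapid_decay_half_line_deriv[OF f] \<nu>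
    unfolding set_integrable_def by (intro integrable_norm) auto
  let ?I = "LINT x|lborel. norm (indicator {0<..} x *\<^sub>R (of_real x powr (\<nu> + of_nat (k + 1)) * ?h x))"
  have "y ^ k * norm (hankel_core \<nu> f y) \<le> C * ?I" if y: "y > 0" for y
  proof -
    have "norm (hankel_core \<nu> f y) = norm (hankel_core (\<nu> + of_nat m) ?h y)"
      using hankel_core_half_line_deriv[OF \<nu> f y, of m] by (simp add: norm_mult norm_power)
    also have "\<dots> \<le> (LINT x|lborel. C / y ^ k * norm (indicator {0<..} x *\<^sub>R (of_real x powr (\<nu> + of_nat (k + 1)) * ?h x)))"
      unfolding hankel_core_def set_lebesgue_integral_def
    proof (rule Bochner_Integration.integral_norm_bound_integral)
      show "integrable lborel (\<lambda>x. indicator {0<..} x *\<^sub>R (of_real x powr (\<nu> + of_nat m) *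
          (?h x * bessel_clifford (\<nu> + of_nat m) (of_real (x * y)))))"
        using rapid_decay_set_integrable[OF _ rapid_decay_mult_bessel_clifford[OF rapid_decay_half_line_deriv[OF f]],
            of "\<nu> + of_nat m" "\<nu> + of_nat m" y m] \<nu> y
        unfolding set_integrable_def by auto
      fix x :: real
      have "norm (of_real x powr (\<nu> + of_nat m) * (?h x * bessel_clifford (\<nu> + of_nat m) (of_real (x * y))))
          \<le> C / y ^ k * norm (of_real x powr (\<nu> + of_nat (k + 1)) * ?h x)" if x: "x > 0"
      proof -
        have "norm (bessel_clifford (\<nu> + of_nat m) (of_real (x * y))) \<le> C / (x * y) ^ k"
          using C(2)[of "x * y"] x y by (simp add: field_simps)
        then have "norm (of_real x powr (\<nu> + of_nat m) * (?h x * bessel_clifford (\<nu> + of_nat m) (of_real (x * y))))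
          \<le> x powr (Re \<nu> + real m) * (norm (?h x) * (C / (x * y) ^ k))"
          unfolding norm_mult using x by (intro mult_mono) (auto simp: norm_powr_real_powr)
        also have "x powr (Re \<nu> + real m) = x powr (Re \<nu> + real (k + 1)) * x ^ k"
          using x by (simp add: m_def powr_realpow[symmetric] powr_add[symmetric] algebra_simps)
        finally show ?thesis
          using x by (simp add: norm_mult norm_powr_real_powr power_mult_distrib mult_ac)
      qed
      then show "norm (indicator {0<..} x *\<^sub>R (of_real x powr (\<nu> + of_nat m) *
          (?h x * bessel_clifford (\<nu> + of_nat m) (of_real (x * y)))))
        \<le> C / y ^ k * norm (indicator {0<..} x *\<^sub>R (of_real x powr (\<nu> + of_nat (k + 1)) * ?h x))"
        by (cases "x > 0") auto
    qed (intro integrable_mult_right int)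
    also have "\<dots> = C / y ^ k * ?I" by simp
    finally show ?thesis using y by (simp add: field_simps)
  qed
  moreover have "C * ?I \<ge> 0" using C(1) by (intro mult_nonneg_nonneg) auto
  ultimately show ?thesis by blast
qed

lemma rapid_decay_hankel_core:
  assumes \<nu>: "Re \<nu> > -1" and f: "f \<in> schwartz_half_line"
  shows "rapid_decay (hankel_core \<nu> f)"
  unfolding rapid_decay_def
proof (intro conjI allI)
  note [measurable] = borel_measurable_bessel_clifford[OF \<nu>]
  have [measurable]: "(\<lambda>x. indicator {0<..} x *\<^sub>R (of_real x powr \<nu> * f x)) \<in> borel_measurable borel"
    using rapid_decay_set_integrable[OF \<nu> rapid_decay_half_line_deriv[OF f, of 0]]
    by (auto simp: set_integrable_def half_line_deriv_def dest: borel_measurable_integrable)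
  have "hankel_core \<nu> f = (\<lambda>y. LINT x|lborel. indicator {0<..} x *\<^sub>R (of_real x powr \<nu> * f x) * bessel_clifford \<nu> (of_real (x * y)))"
    by (auto simp: hankel_core_def set_lebesgue_integral_def mult_ac)
  also have "\<dots> \<in> borel_measurable borel" by measurable
  finally have [measurable]: "hankel_core \<nu> f \<in> borel_measurable borel" .
  show "(\<lambda>y. indicator {0<..} y *\<^sub>R hankel_core \<nu> f y) \<in> borel_measurable borel" by measurable
next
  fix k
  \<comment> \<open>The exponents 0 and \<open>k\<close> control \<open>y \<le> 1\<close> and
    \<open>y \<ge> 1\<close> respectively, and \<open>1 + y \<le> 2 * max 1 y\<close> combines
    them.\<close>
  obtain C0 where C0: "\<And>y. y > 0 \<Longrightarrow> y ^ 0 * norm (hankel_core \<nu> f y) \<le> C0"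
    using hankel_core_decay[OF assms, of 0] by blast
  obtain C where C: "\<And>y. y > 0 \<Longrightarrow> y ^ k * norm (hankel_core \<nu> f y) \<le> C"
    using hankel_core_decay[OF assms, of k] by blast
  have "(1 + y) ^ k * norm (hankel_core \<nu> f y) \<le> 2 ^ k * max C0 C" if y: "y > 0" for y
  proof -
    have "(1 + y) ^ k \<le> (2 * max 1 y) ^ k" using y by (intro power_mono) auto
    then have "(1 + y) ^ k * norm (hankel_core \<nu> f y) \<le> (2 * max 1 y) ^ k * norm (hankel_core \<nu> f y)"
      by (rule mult_right_mono) simp
    also have "\<dots> = 2 ^ k * ((max 1 y) ^ k * norm (hankel_core \<nu> f y))"
      by (simp add: power_mult_distrib)
    also have "\<dots> \<le> 2 ^ k * max C0 C"
      using C0[OF y] C[OF y] by (intro mult_left_mono) (auto simp: max_def split: if_splits)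
    finally show ?thesis .
  qed
  then show "\<exists>C. \<forall>y>0. (1 + y) ^ k * norm (hankel_core \<nu> f y) \<le> C" by blast
qed

text \<open>Supplies the product majorant for the application of Fubini's theorem to the Laplace
  transform of \<open>hankel_core\<close>.\<close>

lemma integrable_lborel_pair_mult:
  fixes U V :: "real \<Rightarrow> real"
  assumes [measurable]: "integrable lborel U" "integrable lborel V"
  shows "integrable (lborel \<Otimes>\<^sub>M lborel) (\<lambda>(x, y). U x * V y)"
proof (rule lborel_pair.Fubini_integrable)
  show "(\<lambda>(x, y). U x * V y) \<in> borel_measurable (lborel \<Otimes>\<^sub>M lborel)" by measurable
  show "integrable lborel (\<lambda>x. LINT y|lborel. norm (case (x, y) of (x, y) \<Rightarrow> U x * V y))"
    using assms by (simp add: abs_mult)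
  show "AE x in lborel. integrable lborel (\<lambda>y. case (x, y) of (x, y) \<Rightarrow> U x * V y)"
    using assms by simp
qed

text \<open>After exchanging the integrals, the inner one over \<open>y\<close> is the Laplace
  transform of the Bessel-Clifford function.\<close>

lemma laplace_hankel_core:
  assumes \<nu>: "Re \<nu> > -1" and f: "f \<in> schwartz_half_line" and s: "Re s > 0"
  shows "(LINT y:{0<..}|lborel. of_real y powr \<nu> * exp (- (s * of_real y)) * hankel_core \<nu> f y)
    = s powr (- \<nu> - 1) * (LINT x:{0<..}|lborel. of_real x powr \<nu> * f x * exp (- (of_real x / s)))"
proof -
  let ?u = "\<lambda>x. indicator {0<..} x *\<^sub>R (of_real x powr \<nu> * f x)"
  let ?v = "\<lambda>y. indicator {0<..} y *\<^sub>R (of_real y powr \<nu> * exp (- (s * of_real y)))"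
  let ?E = "\<lambda>x y. bessel_clifford \<nu> (of_real (x * y))"
  have fr: "rapid_decay f"
    using rapid_decay_half_line_deriv[OF f, of 0] by (simp add: half_line_deriv_def)
  note [measurable] = borel_measurable_bessel_clifford[OF \<nu>]
  have [measurable]: "?u \<in> borel_measurable borel"
    using rapid_decay_set_integrable[OF \<nu> fr] by (auto simp: set_integrable_def dest: borel_measurable_integrable)
  have [measurable]: "?v \<in> borel_measurable borel"
    using laplace_power_integrable[of "\<nu> + 1" s] \<nu> s by (auto simp: set_integrable_def dest: borel_measurable_integrable)
  obtain C where C: "C \<ge> 0" "\<And>t. t \<ge> 0 \<Longrightarrow> norm (bessel_clifford \<nu> (of_real t)) \<le> C * (1 + t)"
    using bessel_clifford_linear_bound[OF \<nu>] by blast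
  have U: "integrable lborel (\<lambda>x. norm (?u x) * (1 + x))"
  proof -
    have "rapid_decay (\<lambda>x. f x * of_real (1 + x))"
      by (rule rapid_decay_mult[OF fr, of _ 1 1]) (auto intro!: continuous_intros simp del: of_real_add)
    then have "integrable lborel (\<lambda>x. norm (indicator {0<..} x *\<^sub>R (of_real x powr \<nu> * (f x * of_real (1 + x)))))"
      using rapid_decay_set_integrable[OF \<nu>] by (intro integrable_norm) (auto simp: set_integrable_def)
    also have "(\<lambda>x. norm (indicator {0<..} x *\<^sub>R (of_real x powr \<nu> * (f x * of_real (1 + x))))) = (\<lambda>x. norm (?u x) * (1 + x))"
      unfolding norm_scaleR norm_mult norm_of_real by (auto simp: fun_eq_iff indicator_def)
    finally show ?thesis .
  qed
  \<comment> \<open>Expanding \<open>1 + y\<close> gives two Laplace integrands, with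
    \<open>a = \<nu> + 1\<close> and \<open>a = \<nu> + 2\<close>.\<close>
  have V: "integrable lborel (\<lambda>y. norm (?v y) * (1 + y))"
  proof -
    have "integrable lborel (\<lambda>y. norm (indicator {0<..} y *\<^sub>R (of_real y powr (\<nu> + 1 - 1) * exp (- (s * of_real y))))
         + norm (indicator {0<..} y *\<^sub>R (of_real y powr (\<nu> + 2 - 1) * exp (- (s * of_real y)))))"
      using laplace_power_integrable[of "\<nu> + 1" s] laplace_power_integrable[of "\<nu> + 2" s] \<nu> s
      by (intro Bochner_Integration.integrable_add integrable_norm) (auto simp: set_integrable_def)
    also have "(\<lambda>y. norm (indicator {0<..} y *\<^sub>R (of_real y powr (\<nu> + 1 - 1) * exp (- (s * of_real y))))
         + norm (indicator {0<..} y *\<^sub>R (of_real y powr (\<nu> + 2 - 1) * exp (- (s * of_real y)))))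
         = (\<lambda>y. norm (?v y) * (1 + y))"
    proof
      fix y :: real
      have "norm (complex_of_real y powr (\<nu> + 2 - 1)) = norm (complex_of_real y powr \<nu>) * y" if "y > 0"
        using that by (simp add: norm_mult norm_powr_real_powr powr_add)
      then show "norm (indicator {0<..} y *\<^sub>R (of_real y powr (\<nu> + 1 - 1) * exp (- (s * of_real y))))
         + norm (indicator {0<..} y *\<^sub>R (of_real y powr (\<nu> + 2 - 1) * exp (- (s * of_real y))))
         = norm (?v y) * (1 + y)"
        by (cases "y > 0") (simp_all add: norm_mult algebra_simps)
    qed
    finally show ?thesis .
  qed
  \<comment> \<open>The linear bound on the kernel together with
    \<open>1 + x * y \<le> (1 + x) * (1 + y)\<close> separates the variables in the
    majorant.\<close>
  have int: "integrable (lborel \<Otimes>\<^sub>M lborel) (case_prod (\<lambda>x y. ?u x * (?v y * ?E x y)))"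
  proof (rule Bochner_Integration.integrable_bound)
    show "integrable (lborel \<Otimes>\<^sub>M lborel) (\<lambda>(x, y). (C * (norm (?u x) * (1 + x))) * (norm (?v y) * (1 + y)))"
      by (intro integrable_lborel_pair_mult integrable_mult_right U V)
    show "case_prod (\<lambda>x y. ?u x * (?v y * ?E x y)) \<in> borel_measurable (lborel \<Otimes>\<^sub>M lborel)" by measurable
    have "norm (?u x * (?v y * ?E x y)) \<le> norm ((C * (norm (?u x) * (1 + x))) * (norm (?v y) * (1 + y)))" for x y
    proof (cases "x > 0 \<and> y > 0")
      case True
      then have "norm (?E x y) \<le> C * (1 + x * y)" by (intro C(2)) auto
      also have "\<dots> \<le> C * ((1 + x) * (1 + y))"
        using True C(1) by (intro mult_left_mono) (auto simp: algebra_simps)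
      finally have "norm (?u x) * (norm (?v y) * norm (?E x y)) \<le> norm (?u x) * (norm (?v y) * (C * ((1 + x) * (1 + y))))"
        by (intro mult_left_mono) auto
      also have "\<dots> = norm ((C * (norm (?u x) * (1 + x))) * (norm (?v y) * (1 + y)))"
        using True C(1) by (simp add: abs_mult mult_ac)
      finally show ?thesis by (simp only: norm_mult)
    qed auto
    then show "AE z in lborel \<Otimes>\<^sub>M lborel. norm (case z of (x, y) \<Rightarrow> ?u x * (?v y * ?E x y)) \<le>
        norm (case z of (x, y) \<Rightarrow> (C * (norm (?u x) * (1 + x))) * (norm (?v y) * (1 + y)))"
      by (intro AE_I2) (auto split: prod.split)
  qed
  have "(LINT y:{0<..}|lborel. of_real y powr \<nu> * exp (- (s * of_real y)) * hankel_core \<nu> f y)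
      = (LINT y|lborel. LINT x|lborel. ?u x * (?v y * ?E x y))"
    unfolding set_lebesgue_integral_def
  proof (rule Bochner_Integration.integral_cong[OF refl])
    fix y :: real
    have "?v y * (LINT x|lborel. ?u x * ?E x y) = (LINT x|lborel. ?v y * (?u x * ?E x y))"
      by (rule integral_mult_right_zero[symmetric])
    also have "(LINT x|lborel. ?u x * ?E x y) = hankel_core \<nu> f y"
      unfolding hankel_core_def set_lebesgue_integral_def by (simp add: mult.assoc)
    finally show "indicator {0<..} y *\<^sub>R (of_real y powr \<nu> * exp (- (s * of_real y)) * hankel_core \<nu> f y) =
        (LINT x|lborel. ?u x * (?v y * ?E x y))"
      by (simp add: mult_ac)
  qed
  also have "\<dots> = (LINT x|lborel. LINT y|lborel. ?u x * (?v y * ?E x y))"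
    by (rule lborel_pair.Fubini_integral[OF int])
  also have "\<dots> = (LINT x|lborel. s powr (- \<nu> - 1) * (indicator {0<..} x *\<^sub>R (of_real x powr \<nu> * f x * exp (- (of_real x / s)))))"
  proof (rule Bochner_Integration.integral_cong[OF refl])
    fix x :: real
    have "(LINT y|lborel. ?u x * (?v y * ?E x y)) = ?u x * (LINT y|lborel. ?v y * ?E x y)"
      by (rule integral_mult_right_zero)
    also have "\<dots> = ?u x * (s powr (- \<nu> - 1) * exp (- (of_real x / s)))"
      using laplace_bessel_clifford[OF \<nu> s, of x] by (cases "x > 0") (simp_all add: set_lebesgue_integral_def)
    finally show "(LINT y|lborel. ?u x * (?v y * ?E x y)) =
        s powr (- \<nu> - 1) * (indicator {0<..} x *\<^sub>R (of_real x powr \<nu> * f x * exp (- (of_real x / s))))"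
      by (simp add: mult_ac)
  qed
  also have "\<dots> = s powr (- \<nu> - 1) * (LINT x:{0<..}|lborel. of_real x powr \<nu> * f x * exp (- (of_real x / s)))"
    unfolding set_lebesgue_integral_def by (rule integral_mult_right_zero)
  finally show ?thesis .
qed

section \<open>Passage from the right half plane to the imaginary axis\<close>

lemma fourier_hankel_core:
  assumes \<nu>: "Re \<nu> > -1" and f: "f \<in> schwartz_half_line" and z: "z \<noteq> 0"
  shows "(LINT y:{0<..}|lborel. of_real y powr \<nu> * hankel_core \<nu> f y * exp (\<i> * of_real y * of_real z))
    = (- \<i> * of_real z) powr (- \<nu> - 1) *
      (LINT x:{0<..}|lborel. of_real x powr \<nu> * f x * exp (\<i> * of_real x * of_real (- 1 / z)))"
proof -
  define s where "s = (\<lambda>n. of_real (1 / real (Suc n)) - \<i> * complex_of_real z)"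
  have s_pos: "Re (s n) > 0" for n by (simp add: s_def)
  have s_lim: "s \<longlonglongrightarrow> - \<i> * of_real z"
  proof -
    have "(\<lambda>n. complex_of_real (1 / real (Suc n))) \<longlonglongrightarrow> of_real 0"
      by (intro tendsto_of_real) (simp add: divide_inverse LIMSEQ_inverse_real_of_nat del: of_nat_Suc)
    from tendsto_diff[OF this tendsto_const] show ?thesis by (simp add: s_def[abs_def])
  qed
  have fr: "rapid_decay f"
    using rapid_decay_half_line_deriv[OF f, of 0] by (simp add: half_line_deriv_def)
  \<comment> \<open>For \<open>Re (w n) \<ge> 0\<close> the exponential has norm at most 1, so the
    integrand without it is a majorant. This is used on both sides of the Laplace identity, with
    \<open>s n\<close> on the left and \<open>inverse (s n)\<close> on the right.\<close>
  have regularise: "(\<lambda>n. LINT x:{0<..}|lborel. of_real x powr \<nu> * \<phi> x * exp (- (w n * of_real x)))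
      \<longlonglongrightarrow> (LINT x:{0<..}|lborel. of_real x powr \<nu> * \<phi> x * exp (- (w0 * of_real x)))"
    if \<phi>: "rapid_decay \<phi>" and w: "w \<longlonglongrightarrow> w0" "\<And>n. Re (w n) \<ge> 0" for \<phi> w w0
    unfolding set_lebesgue_integral_def
  proof (rule integral_dominated_convergence)
    let ?u = "\<lambda>x. indicator {0<..} x *\<^sub>R (of_real x powr \<nu> * \<phi> x)"
    have u: "integrable lborel ?u"
      using rapid_decay_set_integrable[OF \<nu> \<phi>] by (simp add: set_integrable_def)
    then show "integrable lborel (\<lambda>x. norm (?u x))" by (rule integrable_norm)
    have meas: "(\<lambda>x. indicator {0<..} x *\<^sub>R (of_real x powr \<nu> * \<phi> x * exp (- (v * of_real x)))) \<in> borel_measurable lborel" for v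
    proof -
      have [measurable]: "?u \<in> borel_measurable borel" using u by (auto dest: borel_measurable_integrable)
      have "(\<lambda>x. ?u x * exp (- (v * of_real x))) \<in> borel_measurable lborel" by measurable
      then show ?thesis by simp
    qed
    show "(\<lambda>x. indicator {0<..} x *\<^sub>R (of_real x powr \<nu> * \<phi> x * exp (- (w0 * of_real x)))) \<in> borel_measurable lborel"
      by (rule meas)
    show "(\<lambda>x. indicator {0<..} x *\<^sub>R (of_real x powr \<nu> * \<phi> x * exp (- (w n * of_real x)))) \<in> borel_measurable lborel" for n
      by (rule meas)
    show "AE x in lborel. (\<lambda>n. indicator {0<..} x *\<^sub>R (of_real x powr \<nu> * \<phi> x * exp (- (w n * of_real x))))
        \<longlonglongrightarrow> indicator {0<..} x *\<^sub>R (of_real x powr \<nu> * \<phi> x * exp (- (w0 * of_real x)))"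
      by (intro AE_I2 tendsto_intros w)
    show "AE x in lborel. norm (indicator {0<..} x *\<^sub>R (of_real x powr \<nu> * \<phi> x * exp (- (w n * of_real x)))) \<le> norm (?u x)" for n
      using w(2)[of n] by (intro AE_I2) (auto simp: indicator_def norm_mult intro!: mult_left_le mult_nonneg_nonneg)
  qed
  have "(\<lambda>n. LINT y:{0<..}|lborel. of_real y powr \<nu> * hankel_core \<nu> f y * exp (- (s n * of_real y)))
      \<longlonglongrightarrow> (LINT y:{0<..}|lborel. of_real y powr \<nu> * hankel_core \<nu> f y * exp (- (- \<i> * of_real z * of_real y)))"
    by (intro regularise rapid_decay_hankel_core \<nu> f s_lim less_imp_le[OF s_pos])
  moreover have "(LINT y:{0<..}|lborel. of_real y powr \<nu> * hankel_core \<nu> f y * exp (- (s n * of_real y)))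
      = s n powr (- \<nu> - 1) * (LINT x:{0<..}|lborel. of_real x powr \<nu> * f x * exp (- (inverse (s n) * of_real x)))" for n
    using laplace_hankel_core[OF \<nu> f s_pos[of n]] by (simp add: mult_ac divide_inverse)
  moreover have "(\<lambda>n. s n powr (- \<nu> - 1) * (LINT x:{0<..}|lborel. of_real x powr \<nu> * f x * exp (- (inverse (s n) * of_real x))))
      \<longlonglongrightarrow> (- \<i> * of_real z) powr (- \<nu> - 1) *
        (LINT x:{0<..}|lborel. of_real x powr \<nu> * f x * exp (- (inverse (- \<i> * of_real z) * of_real x)))"
  proof (intro tendsto_mult regularise fr tendsto_inverse s_lim)
    \<comment> \<open>Since \<open>z \<noteq> 0\<close>, the limit \<open>- \<i> * z\<close> lies
      off the branch cut of the principal power.\<close>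
    show "(\<lambda>n. s n powr (- \<nu> - 1)) \<longlonglongrightarrow> (- \<i> * of_real z) powr (- \<nu> - 1)"
      using z by (intro tendsto_powr_complex s_lim tendsto_const) (auto simp: complex_nonpos_Reals_iff)
    show "Re (inverse (s n)) \<ge> 0" for n
      using s_pos[of n] by (simp add: less_imp_le)
  qed (use z in auto)
  ultimately have "(LINT y:{0<..}|lborel. of_real y powr \<nu> * hankel_core \<nu> f y * exp (- (- \<i> * of_real z * of_real y)))
     = (- \<i> * of_real z) powr (- \<nu> - 1) *
        (LINT x:{0<..}|lborel. of_real x powr \<nu> * f x * exp (- (inverse (- \<i> * of_real z) * of_real x)))"
    by (simp add: LIMSEQ_unique)
  moreover have "- (inverse (- \<i> * of_real z) * of_real x) = \<i> * of_real x * of_real (- 1 / z)" for x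
  proof -
    have "inverse (- \<i> * complex_of_real z) = \<i> / of_real z"
      using z by (simp add: complex_eq_iff Re_divide Im_divide power2_eq_square field_simps)
    then show ?thesis by simp
  qed
  ultimately show ?thesis by (simp add: mult_ac)
qed

text \<open>The positive factor \<open>\<bar>z\<bar>\<close> splits off the principal power, and
  \<open>- \<i> * sgn z\<close> has principal argument \<open>- sgn z * pi / 2\<close>; multiplying
  by \<open>- \<nu> - 1\<close> produces the phase of \<open>W_operator\<close>.\<close>

lemma minus_ii_powr:
  fixes z :: real
  assumes "z \<noteq> 0"
  shows "(- \<i> * of_real z) powr (- \<nu> - 1) =
    of_real \<bar>z\<bar> powr (- \<nu> - 1) * exp (of_real (sgn z) * of_real pi * \<i> * (\<nu> + 1) / 2)"
proof -
  have "- \<i> * of_real z = of_real \<bar>z\<bar> * (- \<i> * of_real (sgn z))"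
    by (simp add: mult_ac flip: of_real_mult) (simp add: abs_mult_sgn)
  also have "\<dots> powr (- \<nu> - 1) = of_real \<bar>z\<bar> powr (- \<nu> - 1) * (- \<i> * of_real (sgn z)) powr (- \<nu> - 1)"
    by (rule powr_times_real_left) auto
  also have "(- \<i> * of_real (sgn z)) powr (- \<nu> - 1) = exp (of_real (sgn z) * of_real pi * \<i> * (\<nu> + 1) / 2)"
    using assms by (cases "z > 0") (auto simp: powr_def algebra_simps add_divide_distrib diff_divide_distrib intro!: arg_cong[where f = exp])
  finally show ?thesis .
qed

section \<open>Translation back to the Hankel transform and \<open>T_transform\<close>\<close>

lemma hankel_conv_hankel_core:
  assumes \<nu>: "Re \<nu> > -1" and f: "\<And>x. x \<ge> 0 \<Longrightarrow> f x = of_real x powr (1/2 + \<nu>/2) * f1 x" and y: "y > 0"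
  shows "hankel \<nu> f y = of_real y powr (1/2 + \<nu>/2) * hankel_core \<nu> f1 y"
proof -
  have half: "complex_of_real (sqrt t) = of_real t powr (1/2)" if "t > 0" for t
    using that powr_of_real[of t "1/2"] by (simp add: powr_half_sqrt)
  have "f x * of_real (sqrt (x * y)) * bessel_J \<nu> (2 * sqrt (x * y)) / of_real x
      = of_real y powr (1/2 + \<nu>/2) * (of_real x powr \<nu> * (f1 x * bessel_clifford \<nu> (of_real (x * y))))" if x: "x > 0" for x
  proof -
    let ?X = "complex_of_real x" and ?Y = "complex_of_real y"
    \<comment> \<open>The powers of \<open>x\<close> come from \<open>f\<close>, from the square
      root and from the Bessel function; division by \<open>x\<close> reduces their total exponent
      \<open>\<nu> + 1\<close> to \<open>\<nu>\<close>.\<close>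
    have "?X powr (1/2 + \<nu>/2) * (?X powr (1/2) * ?X powr (\<nu>/2)) / ?X = ?X powr \<nu>"
      using x by (simp add: powr_add[symmetric]) (simp add: powr_add)
    then have X: "?X powr (1/2 + \<nu>/2) * (?X powr (1/2) * ?X powr (\<nu>/2)) = ?X powr \<nu> * ?X"
      using x by (simp add: field_simps)
    have "f x * of_real (sqrt (x * y)) * bessel_J \<nu> (2 * sqrt (x * y)) =
       ?X powr (1/2 + \<nu>/2) * f1 x * (?X powr (1/2) * ?Y powr (1/2)) *
       ((?X powr (\<nu>/2) * ?Y powr (\<nu>/2)) * bessel_clifford \<nu> (of_real (x * y)))"
      using x y f[of x] bessel_J_conv_bessel_clifford[OF \<nu>, of "x * y"] half[of "x * y"]
      by (simp add: powr_times_real)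
    also have "\<dots> = (?X powr (1/2 + \<nu>/2) * (?X powr (1/2) * ?X powr (\<nu>/2))) * (?Y powr (1/2) * ?Y powr (\<nu>/2))
        * (f1 x * bessel_clifford \<nu> (of_real (x * y)))"
      by (simp only: mult_ac)
    also have "\<dots> = ?X powr \<nu> * ?X * ?Y powr (1/2 + \<nu>/2) * (f1 x * bessel_clifford \<nu> (of_real (x * y)))"
      unfolding X by (simp only: powr_add)
    finally show ?thesis using x by simp
  qed
  then have "(LINT x:{0<..}|lborel. f x * of_real (sqrt (x * y)) * bessel_J \<nu> (2 * sqrt (x * y)) / of_real x)
      = (LINT x:{0<..}|lborel. of_real y powr (1/2 + \<nu>/2) * (of_real x powr \<nu> * (f1 x * bessel_clifford \<nu> (of_real (x * y)))))"
    by (intro set_lebesgue_integral_cong) auto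
  then show ?thesis
    using y by (simp add: hankel_def hankel_core_def)
qed

text \<open>The exponents \<open>-1/2 + \<nu>/2\<close> and \<open>1/2 + \<nu>/2\<close> add up to
  \<open>\<nu>\<close>. Asking for the factorisation at \<open>x > 0\<close> only lets the lemma
  serve both \<open>f\<close> and \<open>hankel \<nu> f\<close>.\<close>

lemma T_transform_conv:
  assumes "\<And>x. x > 0 \<Longrightarrow> f x = of_real x powr (1/2 + \<nu>/2) * f1 x"
  shows "T_transform \<nu> f z = of_real ((2 * pi) powr (-1/2)) *
    (LINT x:{0<..}|lborel. of_real x powr \<nu> * f1 x * exp (\<i> * of_real x * of_real z))"
proof -
  have "of_real x powr (-1/2 + \<nu>/2) * f x = of_real x powr \<nu> * f1 x" if "x > 0" for x
    using assms[OF that] by (simp add: powr_add[symmetric] flip: mult.assoc)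
  then have "(LINT x:{0<..}|lborel. of_real x powr (-1/2 + \<nu>/2) * f x * exp (\<i> * of_real x * of_real z))
      = (LINT x:{0<..}|lborel. of_real x powr \<nu> * f1 x * exp (\<i> * of_real x * of_real z))"
    by (intro set_lebesgue_integral_cong) auto
  then show ?thesis unfolding T_transform_def by simp
qed

theorem theorem3p1:
  fixes \<nu> :: complex and f :: "real \<Rightarrow> complex"
  assumes "Re \<nu> > -1"
    and "f \<in> schwartz_hankel \<nu>"
  shows "\<forall>z::real. z \<noteq> 0 \<longrightarrow>
    T_transform \<nu> (hankel \<nu> f) z = W_operator \<nu> (T_transform \<nu> f) z"
proof (intro allI impI)
  fix z :: real assume z: "z \<noteq> 0"
  obtain f1 where f1: "f1 \<in> schwartz_half_line" and f: "\<And>x. x \<ge> 0 \<Longrightarrow> f x = of_real x powr (1/2 + \<nu>/2) * f1 x"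
    using assms(2) unfolding schwartz_hankel_def by blast
  let ?c = "complex_of_real ((2 * pi) powr (-1/2))"
  have "T_transform \<nu> (hankel \<nu> f) z =
      ?c * (LINT y:{0<..}|lborel. of_real y powr \<nu> * hankel_core \<nu> f1 y * exp (\<i> * of_real y * of_real z))"
    by (rule T_transform_conv) (rule hankel_conv_hankel_core[OF assms(1) f])
  also have "\<dots> = (- \<i> * of_real z) powr (- \<nu> - 1) *
      (?c * (LINT x:{0<..}|lborel. of_real x powr \<nu> * f1 x * exp (\<i> * of_real x * of_real (- 1 / z))))"
    unfolding fourier_hankel_core[OF assms(1) f1 z] by (simp only: mult_ac)
  also have "?c * (LINT x:{0<..}|lborel. of_real x powr \<nu> * f1 x * exp (\<i> * of_real x * of_real (- 1 / z)))
      = T_transform \<nu> f (- 1 / z)"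
    by (rule T_transform_conv[symmetric]) (rule f, simp)
  finally show "T_transform \<nu> (hankel \<nu> f) z = W_operator \<nu> (T_transform \<nu> f) z"
    unfolding W_operator_def minus_ii_powr[OF z] .
qed

end
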